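(* For all positive integers $m$ and $n$, the Zhang-Zhang polynomial of the hexagonal flake $O(2,m,n)$ satisfies $$ZZ(O(2,m,n),x)=\det\begin{pmatrix}J_{m,n}(x)&K_{m,n}(x)\\ K_{n,m}(x)&J_{m,n}(x)\end{pmatrix},$$ where $$J_{m,n}(x)=\sum_{r\ge0}\binom mr\binom nr(1+x)^r,\qquad K_{m,n}(x)=\sum_{r\ge0}\binom{m-1}{r}\binom{n+1}{r+2}(1+x)^{r+1}.$$
   Context: A benzenoid graph is a finite $2$-connected plane graph formed by a simply connected union of cells in the hexagonal lattice. A Clar cover of a benzenoid graph $G$ is a spanning subgraph of $G$ each of whose connected components is either a single edge or a hexagonal face (the $6$-cycle bounding a cell). Let $z(G,r)$ be the number of Clar covers of $G$ having exactly $r$ hexagonal components. The Zhang-Zhang polynomial of $G$ is $ZZ(G,x)=\sum_{r\ge0}z(G,r)x^r$. For positive integers $\ell,m,n$, $O(\ell,m,n)$ denotes the hexagonal flake whose successive side lengths (counted in hexagonal cells) are $\ell,m,n,\ell,m,n$. Concretely, if $e_1,e_2,e_3$ are the translation vectors from the center of a cell to the centers of three cyclically consecutive neighbouring cells (so $e_1+e_3=e_2$), then $O(\ell,m,n)$ is the graph formed by the vertices and edges of all cells whose centers are $ae_1+be_2+ce_3$ with integers $0\le a<\ell$, $0\le b<m$, $0\le c<n$. For example, $O(1,2,3)$ is the $2\times3$ parallelogram of hexagons and $O(2,2,2)$ is coronene (seven hexagons). Binomial coefficients $\binom ab$ are $0$ when $b<0$ or $b>a$. *)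

theory Defs
  imports "HOL-Analysis.Analysis" "HOL-Computational_Algebra.Polynomial"
begin

(* Points of the plane are given by integer coordinates with respect to the basis (e1/3, e3/3),
   so that cell centres and vertices of the hexagonal lattice all have integer coordinates.
   A graph is a pair (vertex set, edge set), an edge being the set of its two end points. *)

type_synonym point = "int \<times> int"
type_synonym graph = "point set \<times> point set set"

abbreviation gverts :: "graph \<Rightarrow> point set" where "gverts \<equiv> fst"
abbreviation gedges :: "graph \<Rightarrow> point set set" where "gedges \<equiv> snd"

(* The translations e1, e2 = e1 + e3, e3, -e1, -e2, -e3 from a cell to its six neighbours in cyclic
   order, with coordinates in the basis (e1, e3). *)
definition neighbour_dir :: "nat \<Rightarrow> int \<times> int" where
  "neighbour_dir k = [(1, 0), (1, 1), (0, 1), (-1, 0), (-1, -1), (0, -1)] ! (k mod 6)"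

(* The k-th corner of the cell centred at i e1 + j e3 is the centroid of that centre and the
   centres of its k-th and (k+1)-st neighbours. *)
definition corner :: "int \<times> int \<Rightarrow> nat \<Rightarrow> point" where
  "corner c k = (3 * fst c, 3 * snd c) + neighbour_dir k + neighbour_dir (Suc k)"

definition hexagon :: "int \<times> int \<Rightarrow> graph" where
  "hexagon c = (corner c ` {..<6}, (\<lambda>k. {corner c k, corner c (Suc k)}) ` {..<6})"

definition cells_graph :: "(int \<times> int) set \<Rightarrow> graph" where
  "cells_graph H = (\<Union>c\<in>H. gverts (hexagon c), \<Union>c\<in>H. gedges (hexagon c))"

(* a e1 + b e2 + c e3 = (a + b) e1 + (b + c) e3 *)
definition flake_cells :: "nat \<Rightarrow> nat \<Rightarrow> nat \<Rightarrow> (int \<times> int) set" where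
  "flake_cells l m n =
     {(a + b, b + c) | a b c. 0 \<le> a \<and> a < int l \<and> 0 \<le> b \<and> b < int m \<and> 0 \<le> c \<and> c < int n}"

definition hexagonal_flake :: "nat \<Rightarrow> nat \<Rightarrow> nat \<Rightarrow> graph" where
  "hexagonal_flake l m n = cells_graph (flake_cells l m n)"

definition reachable_set :: "graph \<Rightarrow> point \<Rightarrow> point set" where
  "reachable_set G v = {w. (v, w) \<in> {(x, y). {x, y} \<in> gedges G}\<^sup>*}"

definition component_of :: "graph \<Rightarrow> point \<Rightarrow> graph" where
  "component_of G v = (reachable_set G v, {e \<in> gedges G. e \<subseteq> reachable_set G v})"

definition graph_components :: "graph \<Rightarrow> graph set" where
  "graph_components G = component_of G ` gverts G"

definition spanning_subgraph :: "graph \<Rightarrow> graph \<Rightarrow> bool" where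
  "spanning_subgraph S G \<longleftrightarrow> gverts S = gverts G \<and> gedges S \<subseteq> gedges G"

definition single_edge :: "graph \<Rightarrow> bool" where
  "single_edge K \<longleftrightarrow> (\<exists>u v. u \<noteq> v \<and> K = ({u, v}, {{u, v}}))"

(* A lattice hexagon contained in a subgraph G of the hexagonal lattice is automatically a face
   of G, so no reference to the ambient graph is needed. *)
definition hexagonal_face :: "graph \<Rightarrow> bool" where
  "hexagonal_face K \<longleftrightarrow> (\<exists>c. K = hexagon c)"

definition clar_cover :: "graph \<Rightarrow> graph \<Rightarrow> bool" where
  "clar_cover G S \<longleftrightarrow> spanning_subgraph S G \<and>
     (\<forall>K\<in>graph_components S. single_edge K \<or> hexagonal_face K)"

definition num_clar_covers :: "graph \<Rightarrow> nat \<Rightarrow> nat" where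
  "num_clar_covers G r =
     card {S. clar_cover G S \<and> card {K \<in> graph_components S. hexagonal_face K} = r}"

(* The sum may stop at the number of vertices, since each component contains at least one. *)
definition ZZ_poly :: "graph \<Rightarrow> int poly" where
  "ZZ_poly G = (\<Sum>r\<le>card (gverts G). monom (int (num_clar_covers G r)) r)"

(* [:1, 1:] is the polynomial 1 + x. The omitted terms r > m vanish, as do those of K_poly;
   K_poly is only meaningful for m > 0 because of the truncated subtraction. *)
definition J_poly :: "nat \<Rightarrow> nat \<Rightarrow> int poly" where
  "J_poly m n = (\<Sum>r\<le>m. of_nat ((m choose r) * (n choose r)) * [:1, 1:] ^ r)"

definition K_poly :: "nat \<Rightarrow> nat \<Rightarrow> int poly" where
  "K_poly m n =
     (\<Sum>r\<le>m. of_nat (((m - 1) choose r) * ((n + 1) choose (r + 2))) * [:1, 1:] ^ (r + 1))"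

end

(*
  A Clar cover arises from a perfect matching M by choosing a set of hexagons that carry three M-edges
  of one fixed parity class and adding their other three edges; so ZZ(G,x) is the sum of (1+x)^s(M)
  over the perfect matchings M, where s(M) counts these hexagons. Cutting O(2,m,n) into zigzags, a
  perfect matching becomes a pair of particles moving to the right, i.e. a pair of nested
  partitions, and s(M) becomes a number of corners. The corner generating function of the pairs
  whose largest parts are at most a and b <= a satisfies a recursion in the number of parts with
  the coefficients of a Delannoy recursion, except on the diagonal a = b. The
  determinant satisfies the same recursion: off the diagonal since its entries do, and on the
  diagonal since the differences of neighbouring entries of J and of K agree.
*)

theory Submission
  imports Defs
begin

section \<open>The determinant and its recursion\<close>

text \<open>The determinant looks like a count of two non-crossing lattice paths, but the weight of
  a pair is not a product of weights of its members: whether a corner of the larger partition counts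
  depends on the smaller one. Instead of exchanging tails of paths, the proof removes the last
  parts, and this forces two independent bounds \<open>a\<close> and \<open>b\<close> although only
  \<open>a = b = n\<close> is wanted. \<open>path_det\<close> extends the determinant so that, for
  given \<open>N\<close>, each product has one factor depending on \<open>a\<close> alone and one
  depending on \<open>b\<close> alone; a mixed difference then acts on each factor separately. On
  the diagonal a corner is lost, and another cancellation has to replace this product structure. On
  the side of graphs, fixing one parity class is what produces a power of \<open>1 + x\<close>. An
  edge has opposite parities in the two cells that share it, so hexagons whose odd edges all belong
  to one matching are disjoint, and every subset of them is admissible.\<close>

text \<open>With \<open>1 + x\<close> in place of the variable, \<open>J\<^bsub>N,a\<^esub>\<close> is \<open>bsum x 0 N a\<close> and
  \<open>K\<^bsub>k,l\<^esub>\<close> is \<open>(1 + x) * bsum x 2 (k - 1) (l + 1)\<close>.\<close>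

definition bsum :: "'a::comm_ring_1 \<Rightarrow> nat \<Rightarrow> nat \<Rightarrow> nat \<Rightarrow> 'a" where
  "bsum x d u v = (\<Sum>r\<le>u. of_nat ((u choose r) * (v choose (r + d))) * (1 + x) ^ r)"

lemma bsum_upto:
  assumes "u \<le> k"
  shows "bsum x d u v = (\<Sum>r\<le>k. of_nat ((u choose r) * (v choose (r + d))) * (1 + x) ^ r)"
  unfolding bsum_def using assms by (intro sum.mono_neutral_left) (auto simp: binomial_eq_0)

lemma bsum_Suc_left: "bsum x d (Suc u) v = bsum x d u v + (1 + x) * bsum x (Suc d) u v"
proof -
  have "bsum x d (Suc u) v = of_nat (v choose d) +
      (\<Sum>r\<le>u. of_nat ((Suc u choose Suc r) * (v choose (Suc r + d))) * (1 + x) ^ Suc r)"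
    unfolding bsum_def by (subst sum.atMost_Suc_shift) simp
  also have "\<dots> = (of_nat (v choose d) +
      (\<Sum>r\<le>u. of_nat ((u choose Suc r) * (v choose (Suc r + d))) * (1 + x) ^ Suc r)) +
      (1 + x) * bsum x (Suc d) u v"
    unfolding bsum_def sum_distrib_left add.assoc sum.distrib[symmetric]
    by (intro arg_cong2[where f = plus] sum.cong refl) (simp add: algebra_simps)
  also have "of_nat (v choose d) +
      (\<Sum>r\<le>u. of_nat ((u choose Suc r) * (v choose (Suc r + d))) * (1 + x) ^ Suc r) = bsum x d u v"
    unfolding bsum_upto[of u "Suc u" x d v, OF le_SucI[OF order.refl]]
    unfolding sum.atMost_Suc_shift[of _ u] by simp
  finally show ?thesis .
qed

lemma bsum_Suc_right: "bsum x (Suc d) u (Suc v) = bsum x (Suc d) u v + bsum x d u v"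
  unfolding bsum_def sum.distrib[symmetric]
  by (intro sum.cong refl) (simp add: algebra_simps)

text \<open>The Delannoy recursion with weight \<open>x\<close> on diagonal steps. Pascal's rule in
  \<open>u\<close> first raises \<open>d\<close>, after which Pascal's rule in \<open>v\<close>
  applies and lowers it again; so the entries of both J and K type obey it.\<close>

lemma bsum_Suc_Suc: "bsum x d (Suc u) (Suc v) = bsum x d u (Suc v) + bsum x d (Suc u) v + x * bsum x d u v"
  by (simp add: bsum_Suc_left bsum_Suc_right algebra_simps)

lemma bsum_zero: "v < d \<Longrightarrow> bsum x d u v = 0"
  by (auto simp: bsum_def binomial_eq_0 intro!: sum.neutral)

lemma bsum_0_left: "bsum x d 0 v = of_nat (v choose d)"
  by (simp add: bsum_def)

lemma bsum_0_right: "bsum x 0 u 0 = 1"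
  by (induction u) (simp_all add: bsum_Suc_left bsum_zero bsum_0_left)

text \<open>For \<open>d = 0\<close> a difference in the second argument is out of reach of
  \<open>bsum_Suc_right\<close>; symmetry moves it to the first argument.\<close>

lemma bsum_commute: "bsum x 0 u v = bsum x 0 v u"
proof (induction "u + v" arbitrary: u v rule: less_induct)
  case less
  show ?case
  proof (cases u; cases v)
    fix u' v' assume "u = Suc u'" "v = Suc v'"
    then show ?thesis
      by (simp add: bsum_Suc_Suc less[of u' "Suc v'"] less[of "Suc u'" v'] less[of u' v'])
  qed (simp_all add: bsum_0_left bsum_0_right)
qed

text \<open>The truncated differences are harmless: for \<open>N = 0\<close>, and for \<open>a = b = 0\<close>, the other factor
  of the product vanishes.\<close>

definition path_det :: "'a::comm_ring_1 \<Rightarrow> nat \<Rightarrow> nat \<Rightarrow> nat \<Rightarrow> 'a" where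
  "path_det x N a b = bsum x 0 N a * bsum x 0 N b
     - ((1 + x) * bsum x 2 (a - 1) (N + 1)) * ((1 + x) * bsum x 2 (N - 1) (b + 1))"

lemma path_det_0: "path_det x 0 a b = 1"
  by (simp add: path_det_def bsum_0_left bsum_zero)

lemma path_det_0_right: "path_det x N a 0 = bsum x 0 N a"
  by (simp add: path_det_def bsum_0_right bsum_zero)

text \<open>Each product in \<open>path_det\<close> separates the two bounds, so its mixed
  difference is the product of the differences of its factors, and these are instances of the
  Delannoy recursion. The assumption \<open>k < l\<close> makes \<open>l\<close> positive, so that
  \<open>a - 1\<close> is not truncated; \<open>N = 0\<close> is computed directly because there
  \<open>N - 1\<close> is.\<close>

lemma path_det_Suc_off_diagonal:
  assumes "k < l"
  shows "path_det x (Suc N) (Suc l) (Suc k) - path_det x (Suc N) l (Suc k) - path_det x (Suc N) (Suc l) k + path_det x (Suc N) l k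
    = path_det x N (Suc l) (Suc k) + x * path_det x N l (Suc k) + x * path_det x N (Suc l) k + x^2 * path_det x N l k"
proof -
  obtain l' where l: "l = Suc l'" using assms by (cases l) auto
  show ?thesis
  proof (cases N)
    case 0
    then show ?thesis
      by (simp add: path_det_0 path_det_def bsum_Suc_Suc bsum_Suc_left bsum_Suc_right
          bsum_0_left bsum_zero l numeral_2_eq_2)
        (simp add: algebra_simps power2_eq_square)
  next
    case (Suc N')
    have J: "bsum x 0 (Suc N) (Suc i) - bsum x 0 (Suc N) i = bsum x 0 N (Suc i) + x * bsum x 0 N i" for i
      by (simp add: bsum_Suc_Suc)
    have Ka: "bsum x 2 (Suc l') (Suc (Suc N)) - bsum x 2 l' (Suc (Suc N))
        = bsum x 2 (Suc l') (Suc N) + x * bsum x 2 l' (Suc N)"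
      by (simp add: bsum_Suc_Suc)
    have Kb: "bsum x 2 (Suc N') (Suc (Suc k)) - bsum x 2 (Suc N') (Suc k)
        = bsum x 2 N' (Suc (Suc k)) + x * bsum x 2 N' (Suc k)"
      by (simp add: bsum_Suc_Suc)
    have "path_det x (Suc N) (Suc l) (Suc k) - path_det x (Suc N) l (Suc k) - path_det x (Suc N) (Suc l) k + path_det x (Suc N) l k
      = (bsum x 0 (Suc N) (Suc l) - bsum x 0 (Suc N) l) * (bsum x 0 (Suc N) (Suc k) - bsum x 0 (Suc N) k)
      - (1 + x)^2 * (bsum x 2 (Suc l') (Suc (Suc N)) - bsum x 2 l' (Suc (Suc N))) *
         (bsum x 2 (Suc N') (Suc (Suc k)) - bsum x 2 (Suc N') (Suc k))"
      by (simp add: path_det_def Suc l algebra_simps power2_eq_square)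
    also have "\<dots> = path_det x N (Suc l) (Suc k) + x * path_det x N l (Suc k) + x * path_det x N (Suc l) k + x^2 * path_det x N l k"
      unfolding J Ka Kb by (simp add: path_det_def Suc l algebra_simps power2_eq_square)
    finally show ?thesis .
  qed
qed

text \<open>If the new last parts are equal, the larger partition gains no corner, so only the
  smaller bound is shifted: this is the equation that the term \<open>p = r\<close> of the sum over
  last parts needs.\<close>

lemma path_det_Suc_diagonal:
  "path_det x (Suc N) (Suc l) (Suc l) - path_det x (Suc N) (Suc l) l = path_det x N (Suc l) (Suc l) + x * path_det x N (Suc l) l"
proof (cases N)
  case 0
  have "bsum x 0 (Suc 0) i = 1 + (1 + x) * of_nat i" for i
    by (simp add: bsum_Suc_left bsum_0_left)
  moreover have "bsum x 2 i (Suc (Suc 0)) = 1" for i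
    by (simp add: bsum_zero bsum_0_left bsum_Suc_right numeral_2_eq_2 bsum_0_right)
  ultimately show ?thesis
    using 0 by (simp add: path_det_0 path_det_def bsum_0_left bsum_zero numeral_2_eq_2 bsum_Suc_right)
      (simp add: algebra_simps)
next
  case (Suc N')
  \<comment> \<open>After moving everything to one side, the equation becomes \<open>J' * J = (1 + x)^2 * Ka * Kb\<close>
    for the left-hand sides of \<open>J\<close>, \<open>J'\<close>, \<open>Ka\<close> and \<open>Kb\<close>.\<close>
  have J: "bsum x 0 (Suc N) (Suc l) - bsum x 0 (Suc N) l = (1 + x) * bsum x 1 l (Suc N)"
    unfolding bsum_commute[of x "Suc N"] by (simp add: bsum_Suc_left)
  have J': "bsum x 0 (Suc N) (Suc l) - bsum x 0 N (Suc l) = (1 + x) * bsum x 1 N (Suc l)"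
    by (simp add: bsum_Suc_left)
  have Ka: "bsum x 2 l (Suc (Suc N)) - bsum x 2 l (Suc N) = bsum x 1 l (Suc N)"
    by (simp add: bsum_Suc_right numeral_2_eq_2)
  have Kb: "bsum x 2 N (Suc (Suc l)) - bsum x 2 N (Suc l) = bsum x 1 N (Suc l)"
    by (simp add: bsum_Suc_right numeral_2_eq_2)
  \<comment> \<open>The same differences through the Delannoy recursion: they turn the terms at
    level \<open>N\<close> into multiples of the differences at level \<open>Suc N\<close>, so that
    the products can be combined.\<close>
  have J2: "bsum x 0 (Suc N) (Suc l) - bsum x 0 (Suc N) l = bsum x 0 N (Suc l) + x * bsum x 0 N l"
    by (simp add: bsum_Suc_Suc)
  have Kb2: "bsum x 2 N (Suc (Suc l)) - bsum x 2 N (Suc l) = bsum x 2 N' (Suc (Suc l)) + x * bsum x 2 N' (Suc l)"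
    by (simp add: bsum_Suc_Suc Suc)
  have "path_det x (Suc N) (Suc l) (Suc l) - path_det x (Suc N) (Suc l) l
      - (path_det x N (Suc l) (Suc l) + x * path_det x N (Suc l) l)
    = bsum x 0 (Suc N) (Suc l) * (bsum x 0 (Suc N) (Suc l) - bsum x 0 (Suc N) l)
      - (1 + x)^2 * bsum x 2 l (Suc (Suc N)) * (bsum x 2 N (Suc (Suc l)) - bsum x 2 N (Suc l))
      - bsum x 0 N (Suc l) * (bsum x 0 N (Suc l) + x * bsum x 0 N l)
      + (1 + x)^2 * bsum x 2 l (Suc N) * (bsum x 2 N' (Suc (Suc l)) + x * bsum x 2 N' (Suc l))"
    by (simp add: path_det_def Suc algebra_simps power2_eq_square)
  also have "\<dots> = (bsum x 0 (Suc N) (Suc l) - bsum x 0 N (Suc l)) * (bsum x 0 (Suc N) (Suc l) - bsum x 0 (Suc N) l)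
      - (1 + x)^2 * (bsum x 2 l (Suc (Suc N)) - bsum x 2 l (Suc N)) * (bsum x 2 N (Suc (Suc l)) - bsum x 2 N (Suc l))"
    unfolding J2[symmetric] Kb2[symmetric] by (simp add: algebra_simps)
  also have "\<dots> = 0"
    unfolding J J' Ka Kb by (simp add: algebra_simps power2_eq_square)
  finally show ?thesis by simp
qed

text \<open>Appending last parts \<open>r\<close> and \<open>p\<close> to a pair of partitions creates a corner, of weight \<open>1 + x\<close>, for each of
  the two parts that exceeds its predecessor, except for \<open>r\<close> if \<open>r = p\<close>. If \<open>F a b\<close> counts the pairs
  with parts at most \<open>a\<close> and \<open>b\<close>, the summands \<open>x\<close> of these weights give the shifted terms.\<close>

definition last_step :: "'a::comm_ring_1 \<Rightarrow> (nat \<Rightarrow> nat \<Rightarrow> 'a) \<Rightarrow> nat \<Rightarrow> nat \<Rightarrow> 'a" where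
  "last_step x F r p = F r p + (if 0 < p then x * F r (p - 1) else 0) +
     (if p < r then x * F (r - 1) p + (if 0 < p then x^2 * F (r - 1) (p - 1) else 0) else 0)"

text \<open>The off-diagonal recursion telescopes in the second bound. At \<open>p = 0\<close> the
  product of the K-type factors vanishes, and the recursion of the J-type entry starts the
  sum.\<close>

lemma sum_last_step_below:
  "k \<le> l \<Longrightarrow> (\<Sum>p\<le>k. last_step x (path_det x N) (Suc l) p) = path_det x (Suc N) (Suc l) k - path_det x (Suc N) l k"
proof (induction k)
  case 0
  then show ?case by (simp add: last_step_def path_det_0_right bsum_Suc_Suc)
next
  case (Suc k)
  then show ?case
    using path_det_Suc_off_diagonal[of k l x N] by (simp add: last_step_def[of _ _ _ "Suc k"]) (simp add: algebra_simps)
qed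

lemma sum_last_step_diag:
  "(\<Sum>p\<le>Suc l. last_step x (path_det x N) (Suc l) p) = path_det x (Suc N) (Suc l) (Suc l) - path_det x (Suc N) l l"
  using sum_last_step_below[of l l x N] path_det_Suc_diagonal[of x N l] by (simp add: last_step_def algebra_simps)

lemma sum_last_step_square:
  "(\<Sum>r\<le>b. \<Sum>p\<le>r. last_step x (path_det x N) r p) = path_det x (Suc N) b b"
proof (induction b)
  case (Suc b)
  show ?case
    unfolding sum.atMost_Suc[of "\<lambda>r. \<Sum>p\<le>r. last_step x (path_det x N) r p"] sum_last_step_diag Suc by simp
qed (simp add: last_step_def path_det_0_right bsum_0_right)

text \<open>The last parts with \<open>r \<le> b\<close> fill a triangle, which needs the diagonal
  equation; each further row \<open>r > b\<close> stops at \<open>p = b\<close>, before the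
  diagonal.\<close>

lemma sum_last_step_path_det:
  assumes "b \<le> a"
  shows "(\<Sum>r\<le>a. \<Sum>p\<le>min b r. last_step x (path_det x N) r p) = path_det x (Suc N) a b"
  using assms
proof (induction a rule: dec_induct)
  case base
  show ?case by (subst sum_last_step_square[symmetric]) (auto intro!: sum.cong)
next
  case (step a)
  then show ?case by (simp add: sum_last_step_below)
qed

section \<open>Pairs of nested partitions\<close>

text \<open>The parts with the indices \<open>1, \<dots>, N\<close> are listed in increasing order, after a part \<open>0\<close>. Freezing the
  sequences at \<open>(a, b)\<close> behind them makes \<open>a\<close> and \<open>b\<close> bounds for the parts and the pairs unique as
  functions.\<close>

definition chain_pairs :: "nat \<Rightarrow> nat \<Rightarrow> nat \<Rightarrow> ((nat \<Rightarrow> nat) \<times> (nat \<Rightarrow> nat)) set" where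
  "chain_pairs N a b = {(\<rho>, \<pi>). \<rho> 0 = 0 \<and> \<pi> 0 = 0 \<and>
     (\<forall>i. \<rho> i \<le> \<rho> (Suc i) \<and> \<pi> i \<le> \<pi> (Suc i) \<and> \<pi> i \<le> \<rho> i) \<and> (\<forall>i>N. \<rho> i = a \<and> \<pi> i = b)}"

text \<open>A rise of \<open>\<rho>\<close> that lands on \<open>\<pi>\<close> is not counted: the
  lower particle then leaves its zigzag at an end point of the edge that the corresponding hexagon
  would need in the matching.\<close>

definition corners :: "nat \<Rightarrow> (nat \<Rightarrow> nat) \<times> (nat \<Rightarrow> nat) \<Rightarrow> nat" where
  "corners N = (\<lambda>(\<rho>, \<pi>). \<Sum>i<N. of_bool (\<pi> i < \<pi> (Suc i)) +
     of_bool (\<rho> i < \<rho> (Suc i) \<and> \<pi> (Suc i) < \<rho> (Suc i)))"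

definition set_tail :: "nat \<Rightarrow> nat \<Rightarrow> nat \<Rightarrow> (nat \<Rightarrow> nat) \<times> (nat \<Rightarrow> nat) \<Rightarrow> (nat \<Rightarrow> nat) \<times> (nat \<Rightarrow> nat)" where
  "set_tail N a b = (\<lambda>(\<rho>, \<pi>). (\<lambda>i. if N < i then a else \<rho> i, \<lambda>i. if N < i then b else \<pi> i))"

definition chain_sum :: "'a::comm_ring_1 \<Rightarrow> nat \<Rightarrow> nat \<Rightarrow> nat \<Rightarrow> 'a" where
  "chain_sum x N a b = (\<Sum>f\<in>chain_pairs N a b. (1 + x) ^ corners N f)"

text \<open>\<open>N'\<close> is left free so that one statement covers changing the bounds
  (\<open>N' = N\<close>), dropping a last part and appending one.\<close>

lemma set_tail_mem:
  assumes "f \<in> chain_pairs N' r p" "fst f N \<le> a" "snd f N \<le> b" "b \<le> a"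
  shows "set_tail N a b f \<in> chain_pairs N a b"
  using assms by (auto simp: chain_pairs_def set_tail_def not_less) (metis Suc_lessI not_less less_antisym)+

lemma set_tail_id: "f \<in> chain_pairs N a b \<Longrightarrow> set_tail N a b f = f"
  by (auto simp: chain_pairs_def set_tail_def)

lemma set_tail_set_tail: "set_tail N a b (set_tail N r p f) = set_tail N a b f"
  by (auto simp: set_tail_def split: prod.split)

lemma set_tail_set_tail_Suc: "set_tail N a b (set_tail (Suc N) r p f) = set_tail N a b f"
  by (auto simp: set_tail_def fun_eq_iff split: prod.split)

lemma corners_set_tail: "N \<le> M \<Longrightarrow> corners N (set_tail M a b f) = corners N f"
  by (auto simp: corners_def set_tail_def split: prod.split intro!: sum.cong)

lemma chain_pairs_le:
  assumes "f \<in> chain_pairs N a b" shows "fst f i \<le> a" "snd f i \<le> b" "snd f i \<le> fst f i"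
proof -
  have m: "mono (fst f)" "mono (snd f)"
    using assms by (auto simp: chain_pairs_def mono_iff_le_Suc)
  have e: "fst f (Suc (max i N)) = a" "snd f (Suc (max i N)) = b"
    using assms by (auto simp: chain_pairs_def)
  have "i \<le> Suc (max i N)" by simp
  from monoD[OF m(1) this] monoD[OF m(2) this] e show "fst f i \<le> a" "snd f i \<le> b" by auto
  show "snd f i \<le> fst f i" using assms by (auto simp: chain_pairs_def)
qed

lemma chain_pairs_tail: "f \<in> chain_pairs N a b \<Longrightarrow> N < i \<Longrightarrow> fst f i = a \<and> snd f i = b"
  by (auto simp: chain_pairs_def)

lemma fst_snd_set_tail [simp]:
  "fst (set_tail N a b f) i = (if N < i then a else fst f i)"
  "snd (set_tail N a b f) i = (if N < i then b else snd f i)"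
  by (auto simp: set_tail_def split: prod.split)

lemma finite_chain_pairs: "finite (chain_pairs N a b)"
proof (induction N arbitrary: a b)
  case 0
  have "chain_pairs 0 a b \<subseteq> {(\<lambda>i. if i = 0 then 0 else a, \<lambda>i. if i = 0 then 0 else b)}"
    by (auto simp: chain_pairs_def fun_eq_iff)
  then show ?case by (rule finite_subset) simp
next
  case (Suc N)
  have "chain_pairs (Suc N) a b \<subseteq> (\<Union>r\<in>{..a}. \<Union>p\<in>{..b}. set_tail (Suc N) a b ` chain_pairs N r p)"
  proof
    fix f assume f: "f \<in> chain_pairs (Suc N) a b"
    let ?r = "fst f (Suc N)" and ?p = "snd f (Suc N)"
    have "set_tail N ?r ?p f \<in> chain_pairs N ?r ?p"
      using f by (intro set_tail_mem[OF f]) (auto simp: chain_pairs_def)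
    moreover have "set_tail (Suc N) a b (set_tail N ?r ?p f) = f"
      using f by (auto simp: chain_pairs_def set_tail_def fun_eq_iff less_Suc_eq)
        (metis Suc_lessI)+
    ultimately show "f \<in> (\<Union>r\<in>{..a}. \<Union>p\<in>{..b}. set_tail (Suc N) a b ` chain_pairs N r p)"
      using chain_pairs_le[OF f, of "Suc N"]
      by (intro UN_I[of ?r] UN_I[of ?p] image_eqI[of f _ "set_tail N ?r ?p f"]) auto
  qed
  then show ?case using Suc by (auto intro: finite_subset)
qed

lemma chain_sum_restrict:
  assumes "r' \<le> r" "p' \<le> p" "p' \<le> r'" "p \<le> r"
  shows "(\<Sum>f\<in>{f \<in> chain_pairs N r p. fst f N \<le> r' \<and> snd f N \<le> p'}. (1 + x) ^ corners N f) = chain_sum x N r' p'"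
  unfolding chain_sum_def
proof (rule sum.reindex_bij_witness[where j = "set_tail N r' p'" and i = "set_tail N r p"], goal_cases)
  case (4 f)
  then have "set_tail N r p f \<in> chain_pairs N r p"
    using assms chain_pairs_le[OF 4, of N] by (intro set_tail_mem[OF 4]) auto
  then show ?case using chain_pairs_le[OF 4, of N] by auto
qed (use assms in \<open>auto simp: set_tail_set_tail set_tail_id corners_set_tail intro: set_tail_mem\<close>)

text \<open>The bounds of a pair with \<open>N\<close> parts are its values at the index
  \<open>Suc N\<close>, so they already are the next parts: only the tail behind them has to be
  reset to \<open>(a, b)\<close>.\<close>

lemma chain_sum_Suc_eq_sum:
  assumes "b \<le> a"
  shows "chain_sum x (Suc N) a b = (\<Sum>r\<le>a. \<Sum>p\<le>min b r. \<Sum>f\<in>chain_pairs N r p. (1 + x) ^ corners (Suc N) f)"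
proof -
  let ?S = "SIGMA r : {..a}. SIGMA p : {..min b r}. chain_pairs N r p"
  have "(\<Sum>r\<le>a. \<Sum>p\<le>min b r. \<Sum>f\<in>chain_pairs N r p. (1 + x) ^ corners (Suc N) f)
      = (\<Sum>(r, p, f)\<in>?S. (1 + x) ^ corners (Suc N) f)"
    by (simp add: sum.Sigma finite_chain_pairs split_beta)
  also have "\<dots> = (\<Sum>f\<in>chain_pairs (Suc N) a b. (1 + x) ^ corners (Suc N) f)"
  proof (rule sum.reindex_bij_witness[where i = "\<lambda>f. (fst f (Suc N), snd f (Suc N),
        set_tail N (fst f (Suc N)) (snd f (Suc N)) f)" and j = "\<lambda>(r, p, f). set_tail (Suc N) a b f"], goal_cases)
    case (1 qf)
    then obtain r p f where q: "qf = (r, p, f)" "r \<le> a" "p \<le> min b r" "f \<in> chain_pairs N r p" by auto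
    then show ?case
      using chain_pairs_tail[OF q(4), of "Suc N"] by (simp add: set_tail_set_tail_Suc set_tail_id)
  next
    case (2 qf)
    then obtain r p f where q: "qf = (r, p, f)" "r \<le> a" "p \<le> min b r" "f \<in> chain_pairs N r p" by auto
    then show ?case
      using chain_pairs_tail[OF q(4), of "Suc N"] assms by (auto intro: set_tail_mem)
  next
    case (3 f)
    then show ?case
      by (auto simp: chain_pairs_def set_tail_def fun_eq_iff less_Suc_eq) (metis Suc_lessI)+
  next
    case (4 f)
    have "fst f N \<le> fst f (Suc N)" "snd f N \<le> snd f (Suc N)"
      using 4 by (auto simp: chain_pairs_def)
    then show ?case using chain_pairs_le[OF 4, of "Suc N"] by (auto intro: set_tail_mem[OF 4])
  next
    case (5 qf)
    then show ?case by (auto simp: corners_set_tail)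
  qed
  finally show ?thesis by (simp add: chain_sum_def)
qed

lemma sum_chain_pairs_last_step:
  assumes "p \<le> r"
  shows "(\<Sum>f\<in>chain_pairs N r p. (1 + x) ^ corners (Suc N) f) = last_step x (chain_sum x N) r p"
proof -
  let ?C = "chain_pairs N r p" and ?w = "\<lambda>f. (1 + x) ^ corners N f"
  let ?P = "\<lambda>f. snd f N < p" and ?R = "\<lambda>f. fst f N < r \<and> p < r"
  have G1: "(\<Sum>f\<in>?C. ?w f) = chain_sum x N r p" by (simp add: chain_sum_def)
  have G2: "(\<Sum>f\<in>?C. if ?P f then ?w f else 0) = (if 0 < p then chain_sum x N r (p - 1) else 0)"
  proof (cases "0 < p")
    case True
    then have "{f \<in> ?C. ?P f} = {f \<in> ?C. fst f N \<le> r \<and> snd f N \<le> p - 1}"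
      using chain_pairs_le(1) by fastforce
    then show ?thesis
      using True assms chain_sum_restrict[of r r "p - 1" p x N] by (simp add: sum.inter_filter[symmetric] finite_chain_pairs)
  qed simp
  have G3: "(\<Sum>f\<in>?C. if ?R f then ?w f else 0) = (if p < r then chain_sum x N (r - 1) p else 0)"
  proof (cases "p < r")
    case True
    then have "{f \<in> ?C. ?R f} = {f \<in> ?C. fst f N \<le> r - 1 \<and> snd f N \<le> p}"
      using chain_pairs_le(2) by fastforce
    then show ?thesis
      using True assms chain_sum_restrict[of "r - 1" r p p x N] by (simp add: sum.inter_filter[symmetric] finite_chain_pairs)
  qed simp
  have G4: "(\<Sum>f\<in>?C. if ?P f \<and> ?R f then ?w f else 0)
      = (if 0 < p \<and> p < r then chain_sum x N (r - 1) (p - 1) else 0)"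
  proof (cases "0 < p \<and> p < r")
    case True
    then have "{f \<in> ?C. ?P f \<and> ?R f} = {f \<in> ?C. fst f N \<le> r - 1 \<and> snd f N \<le> p - 1}"
      by fastforce
    then show ?thesis
      using True assms chain_sum_restrict[of "r - 1" r "p - 1" p x N] diff_le_mono[of p r 1]
      by (simp add: sum.inter_filter[symmetric] finite_chain_pairs)
  qed auto
  \<comment> \<open>Each of the two possible new corners contributes a factor \<open>1 + x\<close>
    or \<open>1\<close>, that is, \<open>1\<close> plus \<open>x\<close> times an indicator; the
    product of both is expanded.\<close>
  have "(\<Sum>f\<in>?C. (1 + x) ^ corners (Suc N) f) = (\<Sum>f\<in>?C. ?w f + x * (if ?P f then ?w f else 0)
      + x * (if ?R f then ?w f else 0) + x^2 * (if ?P f \<and> ?R f then ?w f else 0))"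
  proof (rule sum.cong[OF refl])
    fix f assume f: "f \<in> ?C"
    have "corners (Suc N) f = corners N f + of_bool (?P f) + of_bool (?R f)"
      using chain_pairs_tail[OF f, of "Suc N"] by (auto simp: corners_def split: prod.split)
    then show "(1 + x) ^ corners (Suc N) f = ?w f + x * (if ?P f then ?w f else 0)
      + x * (if ?R f then ?w f else 0) + x^2 * (if ?P f \<and> ?R f then ?w f else 0)"
      by (auto simp: algebra_simps power2_eq_square)
  qed
  also have "\<dots> = last_step x (chain_sum x N) r p"
    unfolding sum.distrib sum_distrib_left[symmetric] G1 G2 G3 G4
    by (auto simp: last_step_def)
  finally show ?thesis .
qed

lemma chain_sum_Suc:
  assumes "b \<le> a"
  shows "chain_sum x (Suc N) a b = (\<Sum>r\<le>a. \<Sum>p\<le>min b r. last_step x (chain_sum x N) r p)"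
  unfolding chain_sum_Suc_eq_sum[OF assms] by (intro sum.cong sum_chain_pairs_last_step) auto

lemma chain_sum_0: "b \<le> a \<Longrightarrow> chain_sum x 0 a b = 1"
proof -
  assume "b \<le> a"
  then have "chain_pairs 0 a b = {(\<lambda>i. if i = 0 then 0 else a, \<lambda>i. if i = 0 then 0 else b)}"
    by (auto simp: chain_pairs_def fun_eq_iff)
  then show ?thesis by (simp add: chain_sum_def corners_def)
qed

lemma chain_sum_eq_path_det: "b \<le> a \<Longrightarrow> chain_sum x N a b = path_det x N a b"
proof (induction N arbitrary: a b)
  case 0
  then show ?case by (simp add: chain_sum_0 path_det_0)
next
  case (Suc N)
  \<comment> \<open>For \<open>p \<le> r\<close> the guards in \<open>last_step\<close> keep every
    value it reads in the region where the second bound is at most the first, so the induction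
    hypothesis applies.\<close>
  have "last_step x (chain_sum x N) r p = last_step x (path_det x N) r p" if "p \<le> r" for r p
    using that Suc.IH by (auto simp: last_step_def)
  then show ?case
    unfolding chain_sum_Suc[OF Suc.prems] sum_last_step_path_det[OF Suc.prems, symmetric]
    by (intro sum.cong) auto
qed

section \<open>Clar covers and perfect matchings\<close>

definition odd_edges :: "int \<times> int \<Rightarrow> point set set" where
  "odd_edges c = (\<lambda>k. {corner c k, corner c (Suc k)}) ` {1, 3, 5}"

definition even_edges :: "int \<times> int \<Rightarrow> point set set" where
  "even_edges c = (\<lambda>k. {corner c k, corner c (Suc k)}) ` {0, 2, 4}"

lemma corner_simps:
  "corner (i, j) 0 = (3 * i + 2, 3 * j + 1)"
  "corner (i, j) (Suc 0) = (3 * i + 1, 3 * j + 2)"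
  "corner (i, j) (Suc (Suc 0)) = (3 * i - 1, 3 * j + 1)"
  "corner (i, j) (Suc (Suc (Suc 0))) = (3 * i - 2, 3 * j - 1)"
  "corner (i, j) (Suc (Suc (Suc (Suc 0)))) = (3 * i - 1, 3 * j - 2)"
  "corner (i, j) (Suc (Suc (Suc (Suc (Suc 0))))) = (3 * i + 1, 3 * j - 1)"
  "corner (i, j) (Suc (Suc (Suc (Suc (Suc (Suc 0)))))) = (3 * i + 2, 3 * j + 1)"
  by (simp_all add: corner_def neighbour_dir_def)

lemma odd_edges_eq:
  "odd_edges (i, j) = {{(3 * i + 1, 3 * j + 2), (3 * i - 1, 3 * j + 1)},
     {(3 * i - 2, 3 * j - 1), (3 * i - 1, 3 * j - 2)}, {(3 * i + 1, 3 * j - 1), (3 * i + 2, 3 * j + 1)}}"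
  by (simp add: odd_edges_def eval_nat_numeral corner_simps)

lemma even_edges_eq:
  "even_edges (i, j) = {{(3 * i + 2, 3 * j + 1), (3 * i + 1, 3 * j + 2)},
     {(3 * i - 1, 3 * j + 1), (3 * i - 2, 3 * j - 1)}, {(3 * i - 1, 3 * j - 2), (3 * i + 1, 3 * j - 1)}}"
  by (simp add: even_edges_def eval_nat_numeral corner_simps)

lemma lessThan_6: "{..<6::nat} = {0, 1, 2, 3, 4, 5}"
  by auto

lemma gverts_hexagon_eq:
  "gverts (hexagon (i, j)) = {(3 * i + 2, 3 * j + 1), (3 * i + 1, 3 * j + 2), (3 * i - 1, 3 * j + 1),
     (3 * i - 2, 3 * j - 1), (3 * i - 1, 3 * j - 2), (3 * i + 1, 3 * j - 1)}"
  unfolding hexagon_def lessThan_6 by (simp add: eval_nat_numeral corner_simps)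

lemma gedges_hexagon: "gedges (hexagon c) = odd_edges c \<union> even_edges c"
  unfolding hexagon_def lessThan_6 odd_edges_def even_edges_def by auto

lemma odd_even_disjoint: "e \<in> odd_edges c \<Longrightarrow> e \<notin> even_edges c"
  by (cases c) (auto simp: odd_edges_eq even_edges_eq doubleton_eq_iff)

lemma ex_odd_edge: "v \<in> gverts (hexagon c) \<Longrightarrow> \<exists>e\<in>odd_edges c. v \<in> e"
  by (cases c) (auto simp: odd_edges_eq gverts_hexagon_eq)

lemma hexagon_edge_subset: "e \<in> gedges (hexagon c) \<Longrightarrow> e \<subseteq> gverts (hexagon c)"
  by (cases c) (auto simp: gedges_hexagon odd_edges_eq even_edges_eq gverts_hexagon_eq)

lemma hexagon_edge_pair:
  assumes "e \<in> gedges (hexagon c)"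
  obtains u w where "u \<noteq> w" "e = {u, w}"
proof -
  have "\<forall>k\<in>{..<6}. corner c k \<noteq> corner c (Suc k)"
    unfolding lessThan_6 by (cases c) (simp add: eval_nat_numeral corner_simps)
  moreover obtain k where "k < 6" "e = {corner c k, corner c (Suc k)}"
    using assms by (auto simp: hexagon_def)
  ultimately show thesis using that by blast
qed

lemma odd_edge_unique: "v \<in> e \<Longrightarrow> v \<in> e' \<Longrightarrow> e \<in> odd_edges c \<Longrightarrow> e' \<in> odd_edges c \<Longrightarrow> e = e'"
  by (cases c) (auto simp: odd_edges_eq)

lemma odd_edges_disjoint:
  assumes "e \<in> odd_edges c" "e \<in> odd_edges c'"
  shows "c = c'"
proof -
  \<comment> \<open>The sum of the two end points is six times the cell plus one of three offsets
    that differ modulo 6, so it determines the cell.\<close>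
  have "\<exists>a b. (a, b) \<in> {(0, 3), (- 3, - 3), (3, 0)} \<and> sum fst e = 6 * fst c + a \<and> sum snd e = 6 * snd c + b"
    if "e \<in> odd_edges c" for c
    using that by (cases c) (auto simp: odd_edges_eq)
  from this[OF assms(1)] this[OF assms(2)] show ?thesis
    unfolding prod_eq_iff by (elim exE conjE insertE) (simp_all, presburger+)
qed

lemma corner_0_inj: "corner c 0 = corner c' 0 \<Longrightarrow> c = c'"
  by (cases c; cases c') (auto simp: corner_simps)

lemma corner_mem_hexagon: "k < 6 \<Longrightarrow> corner c k \<in> gverts (hexagon c)"
  by (simp add: hexagon_def)

section \<open>Connected components\<close>

lemma sym_adjacency: "sym ({(x, y). {x, y} \<in> E}\<^sup>*)"
  by (rule sym_rtrancl) (auto simp: sym_def insert_commute)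

lemma hexagon_connected:
  assumes "gedges (hexagon c) \<subseteq> E" "v \<in> gverts (hexagon c)" "w \<in> gverts (hexagon c)"
  shows "(v, w) \<in> {(x, y). {x, y} \<in> E}\<^sup>*"
proof -
  let ?R = "{(x, y). {x, y} \<in> E}"
  have step: "(corner c k, corner c (Suc k)) \<in> ?R" if "k < 6" for k
    using assms(1) that by (auto simp: hexagon_def)
  have from0: "(corner c 0, corner c k) \<in> ?R\<^sup>*" if "k < 6" for k
    using that
  proof (induction k)
    case (Suc k)
    then show ?case using rtrancl_into_rtrancl[OF _ step[of k]] Suc_lessD by blast
  qed simp
  obtain k l where kl: "k < 6" "v = corner c k" "l < 6" "w = corner c l"
    using assms(2,3) by (auto simp: hexagon_def)
  have "(v, corner c 0) \<in> ?R\<^sup>*"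
    unfolding kl(2) by (rule symD[OF sym_adjacency from0[OF kl(1)]])
  then show ?thesis
    unfolding kl(4) using from0[OF kl(3)] by (rule rtrancl_trans)
qed

lemma hexagon_not_single_edge: "\<not> single_edge (hexagon c)"
proof
  assume "single_edge (hexagon c)"
  then obtain u w where "gverts (hexagon c) = {u, w}" by (auto simp: single_edge_def)
  moreover have "card (gverts (hexagon c)) = 6"
    by (cases c) (simp add: gverts_hexagon_eq)
  moreover have "card {u, w} \<le> 2" by (simp add: card_insert_if)
  ultimately show False by simp
qed

lemma hexagon_inj:
  assumes "hexagon c = hexagon c'"
  shows "c = c'"
proof -
  have "sum fst (gverts (hexagon c)) = 18 * fst c \<and> sum snd (gverts (hexagon c)) = 18 * snd c" for c
    by (cases c) (simp add: gverts_hexagon_eq)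
  from this[of c] this[of c'] assms show ?thesis by (simp add: prod_eq_iff)
qed

lemma reachable_set_eq:
  assumes "w \<in> reachable_set G v"
  shows "reachable_set G w = reachable_set G v"
proof -
  let ?R = "{(x, y). {x, y} \<in> gedges G}\<^sup>*"
  have vw: "(v, w) \<in> ?R" using assms unfolding reachable_set_def by (rule CollectD)
  have wv: "(w, v) \<in> ?R" by (rule symD[OF sym_adjacency vw])
  have "(w, u) \<in> ?R \<longleftrightarrow> (v, u) \<in> ?R" for u
    using rtrancl_trans[OF vw, of u] rtrancl_trans[OF wv, of u] by (rule iffI)
  then show ?thesis unfolding reachable_set_def by simp
qed

lemma component_unique:
  assumes "K \<in> graph_components G" "v \<in> gverts K"
  shows "K = component_of G v"
proof -
  obtain u where u: "K = component_of G u" using assms(1) unfolding graph_components_def by blast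
  then have "v \<in> reachable_set G u" using assms(2) by (simp add: component_of_def)
  then show ?thesis unfolding u component_of_def by (simp only: reachable_set_eq)
qed

lemma self_reachable: "v \<in> reachable_set G v"
  by (simp add: reachable_set_def)

lemma component_edge:
  assumes "K \<in> graph_components G" "u \<in> gverts K" "{u, w} \<in> gedges G"
  shows "{u, w} \<in> gedges K"
proof -
  have "K = component_of G u" using component_unique assms by blast
  moreover have "w \<in> reachable_set G u" using assms by (auto simp: reachable_set_def)
  ultimately show ?thesis using assms by (auto simp: component_of_def self_reachable)
qed

text \<open>Serves for both kinds of components. The assumption on \<open>{}\<close> is there
  because \<open>component_of\<close> collects the edges contained in the reachable set, and an
  empty edge would be among them without meeting \<open>W\<close>.\<close>

lemma component_of_closed:
  assumes "v \<in> W"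
    and conn: "\<And>w. w \<in> W \<Longrightarrow> (v, w) \<in> {(x, y). {x, y} \<in> gedges G}\<^sup>*"
    and F: "F \<subseteq> gedges G" "\<And>e. e \<in> F \<Longrightarrow> e \<subseteq> W"
    and closed: "\<And>e u. e \<in> gedges G \<Longrightarrow> u \<in> e \<Longrightarrow> u \<in> W \<Longrightarrow> e \<in> F"
    and ne: "{} \<notin> gedges G"
  shows "component_of G v = (W, F)"
proof -
  have "w \<in> W" if "(v, w) \<in> {(x, y). {x, y} \<in> gedges G}\<^sup>*" for w
    using that
  proof (induction rule: rtrancl_induct)
    case (step y z)
    then have "{y, z} \<in> F" using closed[of "{y, z}" y] by blast
    then show ?case using F by blast
  qed (rule assms)
  then have W: "reachable_set G v = W"
    using conn unfolding reachable_set_def by blast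
  have "{e \<in> gedges G. e \<subseteq> W} = F"
  proof (intro set_eqI iffI)
    fix e assume e: "e \<in> {e \<in> gedges G. e \<subseteq> W}"
    then obtain u where "u \<in> e" using ne by (cases "e = {}") blast+
    then show "e \<in> F" using closed[of e u] e by blast
  qed (use F in blast)
  then show ?thesis using W by (simp add: component_of_def)
qed

definition perfect_matchings :: "graph \<Rightarrow> point set set set" where
  "perfect_matchings G = {M. M \<subseteq> gedges G \<and> (\<forall>v\<in>gverts G. \<exists>!e. e \<in> M \<and> v \<in> e)}"

text \<open>\<open>c\<close> ranges over all cells of the lattice; that such a cell belongs to the
  benzenoid is the content of the locale assumption \<open>sextet_closed\<close>.\<close>

definition sextets :: "point set set \<Rightarrow> (int \<times> int) set" where
  "sextets M = {c. odd_edges c \<subseteq> M}"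

text \<open>The hexagons of a Clar cover are those in \<open>C\<close>; their odd edges belong to \<open>M\<close>, so that \<open>M\<close> is recovered by
  removing the even ones.\<close>

definition cover_of :: "graph \<Rightarrow> point set set \<times> (int \<times> int) set \<Rightarrow> graph" where
  "cover_of G = (\<lambda>(M, C). (gverts G, M \<union> (\<Union>c\<in>C. even_edges c)))"

lemma corner_of_edge:
  assumes "v \<in> e" "e \<in> odd_edges c \<union> even_edges c"
  shows "v \<in> gverts (hexagon c)"
  using assms hexagon_edge_subset[of e c] gedges_hexagon by blast

text \<open>The second assumption holds in benzenoids because they have no holes.\<close>

locale sextet_closed =
  fixes H :: "(int \<times> int) set"
  assumes finite_cells: "finite H"
    and sextet_closed: "odd_edges c \<subseteq> gedges (cells_graph H) \<Longrightarrow> c \<in> H"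
begin

abbreviation "G \<equiv> cells_graph H"

lemma finite_G: "finite (gverts G)" "finite (gedges G)"
  using finite_cells by (auto simp: cells_graph_def hexagon_def)

lemma edge_G:
  assumes "e \<in> gedges G" obtains u w where "u \<noteq> w" "e = {u, w}" "u \<in> gverts G" "w \<in> gverts G"
proof -
  obtain c where c: "c \<in> H" "e \<in> gedges (hexagon c)" using assms by (auto simp: cells_graph_def)
  then obtain u w where "u \<noteq> w" "e = {u, w}" using hexagon_edge_pair by metis
  moreover have "e \<subseteq> gverts G"
    using hexagon_edge_subset[OF c(2)] c(1) by (fastforce simp: cells_graph_def)
  ultimately show thesis using that by blast
qed

lemma sextets_subset: "M \<in> perfect_matchings G \<Longrightarrow> sextets M \<subseteq> H"
  using sextet_closed by (auto simp: perfect_matchings_def sextets_def)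

lemma hexagon_subset: "c \<in> H \<Longrightarrow> gverts (hexagon c) \<subseteq> gverts G" "c \<in> H \<Longrightarrow> gedges (hexagon c) \<subseteq> gedges G"
  by (auto simp: cells_graph_def)

text \<open>The sum in \<open>ZZ_poly\<close> stops at the number of vertices; by this bound it
  contains the whole binomial expansion for each matching.\<close>

lemma card_sextets_le:
  assumes "M \<in> perfect_matchings G"
  shows "finite (sextets M)" "card (sextets M) \<le> card (gverts G)"
proof -
  show "finite (sextets M)" using sextets_subset[OF assms] finite_cells finite_subset by blast
  have "(\<lambda>c. corner c 0) ` sextets M \<subseteq> gverts G"
  proof (rule image_subsetI)
    fix c assume "c \<in> sextets M"
    then have "c \<in> H" using sextets_subset[OF assms] by blast
    then show "corner c 0 \<in> gverts G"
      by (rule subsetD[OF hexagon_subset(1) corner_mem_hexagon]) simp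
  qed
  then show "card (sextets M) \<le> card (gverts G)"
    by (rule card_inj_on_le[rotated]) (blast intro: inj_onI corner_0_inj finite_G)+
qed

lemma matching_unique:
  assumes "M \<in> perfect_matchings G" "e \<in> M" "e' \<in> M" "v \<in> e" "v \<in> e'"
  shows "e = e'"
proof -
  have "e \<in> gedges G" using assms by (auto simp: perfect_matchings_def)
  then have "v \<in> gverts G" using assms(4) by (auto elim!: edge_G)
  then show ?thesis using assms by (auto simp: perfect_matchings_def)
qed

section \<open>The cover given by a matching and some of its sextets\<close>

context
  fixes M C S
  assumes M: "M \<in> perfect_matchings G" and C: "C \<subseteq> sextets M" and S: "S = cover_of G (M, C)"
begin

lemma gedges_S: "gedges S = M \<union> (\<Union>c\<in>C. even_edges c)"
  by (simp add: S cover_of_def)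

lemma gverts_S: "gverts S = gverts G"
  by (simp add: S cover_of_def)

lemma C_subset: "C \<subseteq> H"
  using C sextets_subset[OF M] by blast

lemma gedges_S_subset: "gedges S \<subseteq> gedges G"
proof -
  have "even_edges c \<subseteq> gedges G" if "c \<in> C" for c
    using hexagon_subset(2)[of c] that C_subset unfolding gedges_hexagon by blast
  moreover have "M \<subseteq> gedges G" using M by (simp add: perfect_matchings_def)
  ultimately show ?thesis unfolding gedges_S by blast
qed

lemma empty_notin_S: "{} \<notin> gedges S"
  using gedges_S_subset edge_G[of "{}"] by blast

lemma odd_edges_subset: "c \<in> C \<Longrightarrow> odd_edges c \<subseteq> M"
  using C by (auto simp: sextets_def)

lemma matching_edge_at_corner:
  assumes "c \<in> C" "v \<in> gverts (hexagon c)" "e \<in> M" "v \<in> e"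
  shows "e \<in> odd_edges c"
  using ex_odd_edge[OF assms(2)] odd_edges_subset[OF assms(1)] matching_unique[OF M] assms by blast

text \<open>An even edge of a chosen cell \<open>c'\<close> at \<open>v\<close> comes with an odd
  edge of \<open>c'\<close> at \<open>v\<close>. This one belongs to \<open>M\<close>, hence is odd
  for \<open>c\<close> as well, and an edge is odd in one cell only.\<close>

lemma cover_edge_at_corner:
  assumes "c \<in> C" "v \<in> gverts (hexagon c)" "e \<in> gedges S" "v \<in> e"
  shows "e \<in> gedges (hexagon c)"
proof (cases "e \<in> M")
  case True
  then show ?thesis using matching_edge_at_corner assms by (auto simp: gedges_hexagon)
next
  case False
  then obtain c' where c': "c' \<in> C" "e \<in> even_edges c'" using assms gedges_S by blast
  then have "v \<in> gverts (hexagon c')" using corner_of_edge assms(4) by blast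
  then obtain e' where e': "e' \<in> odd_edges c'" "v \<in> e'" using ex_odd_edge by blast
  then have "e' \<in> odd_edges c" using matching_edge_at_corner assms odd_edges_subset c' by blast
  then have "c = c'" using e' odd_edges_disjoint by blast
  then show ?thesis using c' by (auto simp: gedges_hexagon)
qed

lemma component_of_corner:
  assumes "c \<in> C" "v \<in> gverts (hexagon c)"
  shows "component_of S v = hexagon c"
proof -
  have sub: "gedges (hexagon c) \<subseteq> gedges S"
    using odd_edges_subset[OF assms(1)] assms(1) by (auto simp: gedges_hexagon gedges_S)
  have "component_of S v = (gverts (hexagon c), gedges (hexagon c))"
    using assms(2) hexagon_connected[OF sub assms(2)] sub hexagon_edge_subset
      cover_edge_at_corner[OF assms(1)] empty_notin_S
    by (intro component_of_closed) blast+
  then show ?thesis by simp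
qed

text \<open>A chosen hexagon matches its corners among themselves, so the matching edge at
  \<open>u\<close> cannot end in one, and no edge added for \<open>C\<close> touches it.\<close>

lemma component_of_non_corner:
  assumes "u \<in> gverts G" "\<And>c. c \<in> C \<Longrightarrow> u \<notin> gverts (hexagon c)"
  shows "single_edge (component_of S u)"
proof -
  obtain e where e: "e \<in> M" "u \<in> e" using M assms(1) by (auto simp: perfect_matchings_def)
  then have "e \<in> gedges G" using M by (auto simp: perfect_matchings_def)
  then obtain w where w: "e = {u, w}" "u \<noteq> w" using e by (auto elim!: edge_G)
  have nc: "v \<notin> gverts (hexagon c)" if "c \<in> C" "v \<in> e" for c v
  proof
    assume "v \<in> gverts (hexagon c)"
    then have "e \<in> odd_edges c" using matching_edge_at_corner that e by blast
    then show False using corner_of_edge assms(2)[OF that(1)] e by blast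
  qed
  have only: "e' = e" if e': "e' \<in> gedges S" and v: "v \<in> e'" "v \<in> e" for e' v
  proof (cases "e' \<in> M")
    case True
    then show ?thesis using matching_unique[OF M] e' v e by blast
  next
    case False
    then obtain c' where "c' \<in> C" "e' \<in> even_edges c'" using e' unfolding gedges_S by blast
    then show ?thesis using nc[of c' v] v corner_of_edge[of v e' c'] by blast
  qed
  have eS: "e \<in> gedges S" using e gedges_S by blast
  have comp: "component_of S u = (e, {e})"
  proof (rule component_of_closed)
    fix v assume "v \<in> e"
    then consider "v = u" | "v = w" using w by blast
    then show "(u, v) \<in> {(x, y). {x, y} \<in> gedges S}\<^sup>*"
      by cases (use eS w in \<open>simp_all add: r_into_rtrancl\<close>)
  next
    fix e' v assume "e' \<in> gedges S" "v \<in> e'" "v \<in> e"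
    then show "e' \<in> {e}" using only by simp
  qed (use e eS empty_notin_S in simp_all)
  show ?thesis unfolding comp single_edge_def w(1) using w(2) by blast
qed

lemma hexagonal_components: "{K \<in> graph_components S. hexagonal_face K} = hexagon ` C"
proof (intro set_eqI iffI)
  fix K assume "K \<in> {K \<in> graph_components S. hexagonal_face K}"
  then obtain v c where v: "v \<in> gverts G" "K = component_of S v" and c: "K = hexagon c"
    unfolding graph_components_def hexagonal_face_def gverts_S by blast
  then obtain c' where "c' \<in> C" "v \<in> gverts (hexagon c')"
    using component_of_non_corner[OF v(1)] hexagon_not_single_edge[of c] c unfolding v(2) by metis
  then show "K \<in> hexagon ` C" unfolding v(2) using component_of_corner by blast
next
  fix K assume "K \<in> hexagon ` C"
  then obtain c where c: "c \<in> C" "K = hexagon c" by blast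
  have v: "corner c 0 \<in> gverts (hexagon c)" by (rule corner_mem_hexagon) simp
  then have "corner c 0 \<in> gverts S" unfolding gverts_S using c hexagon_subset(1) C_subset by blast
  then have "component_of S (corner c 0) \<in> graph_components S"
    unfolding graph_components_def by blast
  then show "K \<in> {K \<in> graph_components S. hexagonal_face K}"
    unfolding component_of_corner[OF c(1) v] c(2) hexagonal_face_def by blast
qed

lemma cover_of_clar_cover: "clar_cover G S"
  unfolding clar_cover_def spanning_subgraph_def
proof (intro conjI ballI)
  fix K assume "K \<in> graph_components S"
  then obtain v where v: "v \<in> gverts G" "K = component_of S v"
    unfolding graph_components_def gverts_S by blast
  show "single_edge K \<or> hexagonal_face K"
    using component_of_non_corner[OF v(1)] component_of_corner[of _ v] v(2)
    unfolding hexagonal_face_def by blast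
qed (rule gverts_S gedges_S_subset)+

lemma card_hexagonal_components: "card {K \<in> graph_components S. hexagonal_face K} = card C"
  unfolding hexagonal_components by (rule card_image, rule inj_onI, rule hexagon_inj)

text \<open>For the injectivity of \<open>cover_of\<close>: once \<open>C\<close> is read off from
  \<open>S\<close>, \<open>matching_of_cover\<close> recovers \<open>M\<close>.\<close>

lemma cells_of_cover: "C = {c. hexagon c \<in> graph_components S}"
proof (intro set_eqI iffI CollectI)
  fix c assume "c \<in> C"
  then show "hexagon c \<in> graph_components S" using hexagonal_components by blast
next
  fix c assume "c \<in> {c. hexagon c \<in> graph_components S}"
  then have "hexagon c \<in> hexagon ` C"
    unfolding hexagonal_components[symmetric] hexagonal_face_def by blast
  then show "c \<in> C" using hexagon_inj by blast
qed

lemma matching_of_cover: "M = gedges S - (\<Union>c\<in>C. even_edges c)"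
proof -
  have "e \<notin> even_edges c" if "e \<in> M" "c \<in> C" for e c
  proof
    assume ev: "e \<in> even_edges c"
    obtain v where v: "v \<in> e" using hexagon_edge_pair[of e c] ev gedges_hexagon by blast
    then have "v \<in> gverts (hexagon c)" using ev corner_of_edge by blast
    then show False
      using matching_edge_at_corner that v ev odd_even_disjoint by blast
  qed
  then show ?thesis unfolding gedges_S by blast
qed

end

text \<open>Without the even edges of its hexagonal components a cover becomes a perfect matching: a
  vertex on a hexagon keeps exactly one odd edge, any other vertex keeps its isolated edge. Distinct
  components share no vertex, so these deletions do not interfere.\<close>

lemma cover_of_surj:
  assumes "clar_cover G S"
  obtains M C where "M \<in> perfect_matchings G" "C \<subseteq> sextets M" "S = cover_of G (M, C)"
proof -
  define C where "C = {c. hexagon c \<in> graph_components S}"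
  define M where "M = gedges S - (\<Union>c\<in>C. even_edges c)"
  have SG: "gverts S = gverts G" "gedges S \<subseteq> gedges G"
    and comp: "\<And>K. K \<in> graph_components S \<Longrightarrow> single_edge K \<or> hexagonal_face K"
    using assms by (auto simp: clar_cover_def spanning_subgraph_def)
  have sub: "gedges K \<subseteq> gedges S" if "K \<in> graph_components S" for K
    using that unfolding graph_components_def component_of_def by fastforce
  have same: "c = c'" if "c \<in> C" "c' \<in> C" "v \<in> gverts (hexagon c)" "v \<in> gverts (hexagon c')" for c c' v
    using that component_unique[of "hexagon c" S v] component_unique[of "hexagon c'" S v]
    unfolding C_def by (auto intro: hexagon_inj)
  have at: "e \<in> gedges K" if K: "K \<in> graph_components S" "v \<in> gverts K" and e: "v \<in> e" "e \<in> gedges S" for K v e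
  proof -
    obtain u w where "e = {u, w}" using SG(2) e(2) edge_G by blast
    then obtain w' where "e = {v, w'}" using e(1) by blast
    then show ?thesis using component_edge[OF K] e(2) by blast
  qed
  have CM: "C \<subseteq> sextets M"
  proof (unfold sextets_def, intro subsetI CollectI)
    fix c e assume c: "c \<in> C" and e: "e \<in> odd_edges c"
    have "e \<notin> even_edges c'" if c': "c' \<in> C" for c'
    proof
      assume e': "e \<in> even_edges c'"
      obtain v where v: "v \<in> e" using hexagon_edge_pair[of e c] e gedges_hexagon by blast
      then have "c = c'"
        using corner_of_edge e e' by (intro same[OF c c', of v]) blast+
      then show False using e e' odd_even_disjoint by blast
    qed
    moreover have "e \<in> gedges S"
      using sub[of "hexagon c"] c e by (auto simp: C_def gedges_hexagon)
    ultimately show "e \<in> M" unfolding M_def by blast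
  qed
  moreover have "S = cover_of G (M, C)"
  proof -
    have "even_edges c \<subseteq> gedges S" if "c \<in> C" for c
      using that sub[of "hexagon c"] by (auto simp: C_def gedges_hexagon)
    then have "gedges S = M \<union> (\<Union>c\<in>C. even_edges c)" unfolding M_def by blast
    then show ?thesis using SG by (simp add: cover_of_def prod_eq_iff)
  qed
  moreover have "M \<in> perfect_matchings G"
    unfolding perfect_matchings_def
  proof (intro CollectI conjI ballI)
    show "M \<subseteq> gedges G" using SG unfolding M_def by blast
    fix v assume "v \<in> gverts G"
    then have "component_of S v \<in> graph_components S"
      unfolding graph_components_def SG(1)[symmetric] by blast
    moreover define K where "K = component_of S v"
    ultimately have K: "K \<in> graph_components S" "v \<in> gverts K"
      by (simp_all add: component_of_def self_reachable)
    show "\<exists>!e. e \<in> M \<and> v \<in> e"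
    proof (cases "hexagonal_face K")
      case True
      then obtain c where c: "K = hexagon c" unfolding hexagonal_face_def by blast
      then have "c \<in> C" using K by (simp add: C_def)
      obtain e where e: "e \<in> odd_edges c" "v \<in> e" using ex_odd_edge K c by blast
      show ?thesis
      proof (rule ex1I[of _ e])
        show "e \<in> M \<and> v \<in> e" using CM \<open>c \<in> C\<close> e unfolding sextets_def by blast
        fix e' assume e': "e' \<in> M \<and> v \<in> e'"
        then have "e' \<in> gedges (hexagon c)" using at[OF K] c unfolding M_def by blast
        moreover have "e' \<notin> even_edges c" using e' \<open>c \<in> C\<close> unfolding M_def by blast
        ultimately show "e' = e" using e e' odd_edge_unique[of v e' e c] by (simp add: gedges_hexagon)
      qed
    next
      case False
      then obtain u w where uw: "K = ({u, w}, {{u, w}})"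
        using comp[OF K(1)] unfolding single_edge_def by blast
      have "{u, w} \<notin> even_edges c" if c: "c \<in> C" for c
      proof
        assume "{u, w} \<in> even_edges c"
        then have "u \<in> gverts (hexagon c)" using corner_of_edge by blast
        moreover have "hexagon c \<in> graph_components S" using c by (simp add: C_def)
        ultimately have "K = hexagon c"
          using component_unique[of K S u] component_unique[of "hexagon c" S u] K(1) uw by simp
        then show False using False unfolding hexagonal_face_def by blast
      qed
      then have "{u, w} \<in> M" using sub[OF K(1)] uw unfolding M_def by simp
      moreover have "e = {u, w}" if "e \<in> M" "v \<in> e" for e
        using at[OF K that(2)] that(1) uw by (simp add: M_def)
      moreover have "v \<in> {u, w}" using K(2) uw by simp
      ultimately show ?thesis by blast
    qed
  qed
  ultimately show thesis using that by blast
qed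

lemma num_clar_covers_eq:
  "num_clar_covers G r = (\<Sum>M\<in>perfect_matchings G. card (sextets M) choose r)"
proof -
  let ?P = "SIGMA M : perfect_matchings G. {C. C \<subseteq> sextets M \<and> card C = r}"
  let ?Q = "{S. clar_cover G S \<and> card {K \<in> graph_components S. hexagonal_face K} = r}"
  have fin: "finite (perfect_matchings G)"
    by (rule finite_subset[of _ "Pow (gedges G)"]) (auto simp: perfect_matchings_def finite_G)
  have "bij_betw (cover_of G) ?P ?Q"
    unfolding bij_betw_def
  proof
    show "inj_on (cover_of G) ?P"
    proof (rule inj_onI, clarify)
      fix M C M' C'
      assume 1: "M \<in> perfect_matchings G" "C \<subseteq> sextets M" "M' \<in> perfect_matchings G" "C' \<subseteq> sextets M'"
        and eq: "cover_of G (M, C) = cover_of G (M', C')"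
      have "C = C'" using cells_of_cover[OF 1(1,2) refl] cells_of_cover[OF 1(3,4) refl] eq by simp
      then show "M = M' \<and> C = C'"
        using matching_of_cover[OF 1(1,2) refl] matching_of_cover[OF 1(3,4) refl] eq by simp
    qed
    show "cover_of G ` ?P = ?Q"
    proof (intro set_eqI iffI)
      fix S assume "S \<in> cover_of G ` ?P"
      then obtain M C where MC: "M \<in> perfect_matchings G" "C \<subseteq> sextets M" "S = cover_of G (M, C)" "card C = r"
        by blast
      show "S \<in> ?Q"
        using cover_of_clar_cover[OF MC(1-3)] card_hexagonal_components[OF MC(1-3)] MC(4) by simp
    next
      fix S assume S: "S \<in> ?Q"
      then obtain M C where MC: "M \<in> perfect_matchings G" "C \<subseteq> sextets M" "S = cover_of G (M, C)"
        using cover_of_surj by blast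
      then have "card C = r" using card_hexagonal_components[OF MC] S by simp
      then show "S \<in> cover_of G ` ?P" using MC by blast
    qed
  qed
  then have "num_clar_covers G r = card ?P"
    by (simp add: num_clar_covers_def bij_betw_same_card)
  also have "\<dots> = (\<Sum>M\<in>perfect_matchings G. card {C. C \<subseteq> sextets M \<and> card C = r})"
    using card_sextets_le(1) fin by (intro card_SigmaI) auto
  also have "\<dots> = (\<Sum>M\<in>perfect_matchings G. card (sextets M) choose r)"
    using card_sextets_le(1) by (intro sum.cong refl n_subsets) auto
  finally show ?thesis .
qed

lemma ZZ_poly_eq: "ZZ_poly G = (\<Sum>M\<in>perfect_matchings G. (1 + [:0, 1:]) ^ card (sextets M))"
proof -
  let ?n = "card (gverts G)"
  have "ZZ_poly G = (\<Sum>M\<in>perfect_matchings G. \<Sum>r\<le>?n. of_nat (card (sextets M) choose r) * [:0, 1:] ^ r)"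
    unfolding ZZ_poly_def num_clar_covers_eq
    unfolding sum.swap[where A = "perfect_matchings G"] sum_distrib_right[symmetric] of_nat_sum[symmetric]
    by (intro sum.cong refl) (simp add: monom_altdef of_nat_poly)
  also have "\<dots> = (\<Sum>M\<in>perfect_matchings G. (1 + [:0, 1:]) ^ card (sextets M))"
  proof (rule sum.cong[OF refl])
    fix M assume "M \<in> perfect_matchings G"
    then have le: "card (sextets M) \<le> ?n" by (rule card_sextets_le)
    have "(1 + [:0, 1:]) ^ card (sextets M) =
        (\<Sum>r\<le>card (sextets M). of_nat (card (sextets M) choose r) * [:0, 1:] ^ r)"
      by (subst add.commute) (simp add: binomial_ring)
    also have "\<dots> = (\<Sum>r\<le>?n. of_nat (card (sextets M) choose r) * [:0, 1:: int:] ^ r)"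
      using le by (intro sum.mono_neutral_left) (auto simp: binomial_eq_0)
    finally show "(\<Sum>r\<le>?n. of_nat (card (sextets M) choose r) * [:0, 1:: int:] ^ r) =
      (1 + [:0, 1:]) ^ card (sextets M)" by simp
  qed
  finally show ?thesis .
qed

end

section \<open>Perfect matchings of a strip\<close>

definition exactly_one :: "bool \<Rightarrow> bool \<Rightarrow> bool \<Rightarrow> bool" where
  "exactly_one P Q R \<longleftrightarrow> (P \<and> \<not> Q \<and> \<not> R) \<or> (\<not> P \<and> Q \<and> \<not> R) \<or> (\<not> P \<and> \<not> Q \<and> R)"

text \<open>A path \<open>B\<^sub>0 A\<^sub>0 B\<^sub>1 A\<^sub>1 \<dots> B\<^sub>N A\<^sub>N\<close> whose vertices \<open>B\<^sub>t\<close> and \<open>A\<^sub>t\<close> have one further edge each, upwards and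
  downwards, respectively. The predicates tell which edges are matched, \<open>ba t\<close> and \<open>ab t\<close> referring
  to \<open>B\<^sub>t A\<^sub>t\<close> and \<open>A\<^sub>t B\<^sub>t\<^sub>+\<^sub>1\<close>.\<close>

locale zigzag =
  fixes N :: nat and up down ba ab :: "nat \<Rightarrow> bool"
  assumes B: "t \<le> N \<Longrightarrow> exactly_one (ba t) (0 < t \<and> ab (t - 1)) (up t)"
    and A: "t \<le> N \<Longrightarrow> exactly_one (ba t) (ab t) (down t)"
    and stop: "\<not> ab N"
begin

text \<open>Vacuum: if no particle reaches \<open>B_t\<close>, only \<open>A_t\<close> is left as
  its partner, and then \<open>A_t\<close> passes nothing on to the right.\<close>

lemma ba_run:
  assumes "s = 0 \<or> \<not> ab (s - 1)" "\<And>t. s \<le> t \<Longrightarrow> t < e \<Longrightarrow> \<not> up t" "e \<le> Suc N" "s \<le> t" "t < e"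
  shows "ba t \<and> \<not> ab t \<and> \<not> down t"
  using assms(4,5)
proof (induction t rule: dec_induct)
  case base
  then show ?case using assms B[of s] A[of s] by (auto simp: exactly_one_def)
next
  case (step t)
  then show ?case using assms B[of "Suc t"] A[of "Suc t"] by (auto simp: exactly_one_def)
qed

text \<open>A particle entering at \<open>s\<close> blocks \<open>B_s\<close>, so it runs to the
  right along \<open>ab\<close> until the first \<open>A_e\<close> not matched to the right, which
  must be matched downwards. Such an \<open>e\<close> exists by \<open>stop\<close>.\<close>

lemma ab_run:
  assumes "up s" "s \<le> N"
  obtains e where "s \<le> e" "e \<le> N" "down e" "\<not> ab e"
    "\<And>t. s \<le> t \<Longrightarrow> t < e \<Longrightarrow> ab t \<and> \<not> down t"
    "\<And>t. s \<le> t \<Longrightarrow> t \<le> e \<Longrightarrow> \<not> ba t" "\<And>t. s < t \<Longrightarrow> t \<le> e \<Longrightarrow> \<not> up t"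
proof -
  define e where "e = (LEAST t. s \<le> t \<and> \<not> ab t)"
  have ex: "s \<le> N \<and> \<not> ab N" using assms stop by simp
  have e: "s \<le> e" "\<not> ab e" using LeastI[of "\<lambda>t. s \<le> t \<and> \<not> ab t", OF ex] by (auto simp: e_def)
  have eN: "e \<le> N" unfolding e_def by (rule Least_le[of "\<lambda>t. s \<le> t \<and> \<not> ab t", OF ex])
  have run: "ab t" if "s \<le> t" "t < e" for t
    using not_less_Least[of t "\<lambda>t. s \<le> t \<and> \<not> ab t"] that by (auto simp: e_def)
  have nba: "\<not> ba t" if "s \<le> t" "t \<le> e" for t
  proof (cases "t = s")
    case True
    then show ?thesis using assms B[of s] by (auto simp: exactly_one_def)
  next
    case False
    then have "0 < t \<and> ab (t - 1)" using that run[of "t - 1"] by auto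
    then show ?thesis using B[of t] that eN by (auto simp: exactly_one_def)
  qed
  have nup: "\<not> up t" if "s < t" "t \<le> e" for t
  proof -
    have "0 < t \<and> ab (t - 1)" using that run[of "t - 1"] by auto
    then show ?thesis using B[of t] that eN by (auto simp: exactly_one_def)
  qed
  have "down e" using A[OF eN] nba[of e] e by (auto simp: exactly_one_def)
  moreover have "ab t \<and> \<not> down t" if "s \<le> t" "t < e" for t
    using run[OF that] A[of t] that eN by (auto simp: exactly_one_def)
  ultimately show thesis using that e eN nba nup by blast
qed

text \<open>No further upward edge is matched along the run of the first particle, so it has left
  before the second one enters; hence \<open>p' < q\<close>. The gaps between the runs are
  vacuum.\<close>

lemma two_particles:
  assumes up: "\<And>t. t \<le> N \<Longrightarrow> up t \<longleftrightarrow> t = p \<or> t = q" and pq: "p < q" "q \<le> N"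
  obtains p' q' where "p \<le> p'" "p' < q" "q \<le> q'" "q' \<le> N"
    "\<And>t. t \<le> N \<Longrightarrow> down t \<longleftrightarrow> t = p' \<or> t = q'"
    "\<And>t. t \<le> N \<Longrightarrow> ba t \<longleftrightarrow> t < p \<or> p' < t \<and> t < q \<or> q' < t"
    "\<And>t. t \<le> N \<Longrightarrow> ab t \<longleftrightarrow> p \<le> t \<and> t < p' \<or> q \<le> t \<and> t < q'"
proof -
  obtain p' where p': "p \<le> p'" "p' \<le> N" "down p'" "\<not> ab p'"
    "\<And>t. p \<le> t \<Longrightarrow> t < p' \<Longrightarrow> ab t \<and> \<not> down t"
    "\<And>t. p \<le> t \<Longrightarrow> t \<le> p' \<Longrightarrow> \<not> ba t" "\<And>t. p < t \<Longrightarrow> t \<le> p' \<Longrightarrow> \<not> up t"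
    using ab_run[of p] up[of p] pq by auto
  obtain q' where q': "q \<le> q'" "q' \<le> N" "down q'" "\<not> ab q'"
    "\<And>t. q \<le> t \<Longrightarrow> t < q' \<Longrightarrow> ab t \<and> \<not> down t"
    "\<And>t. q \<le> t \<Longrightarrow> t \<le> q' \<Longrightarrow> \<not> ba t" "\<And>t. q < t \<Longrightarrow> t \<le> q' \<Longrightarrow> \<not> up t"
    using ab_run[of q] up[of q] pq by auto
  have p'q: "p' < q" using p'(7)[of q] up[of q] pq not_le_imp_less by blast
  have r1: "ba t \<and> \<not> ab t \<and> \<not> down t" if "t < p" for t
    using ba_run[of 0 p t] that up pq by auto
  have r2: "ba t \<and> \<not> ab t \<and> \<not> down t" if "p' < t" "t < q" for t
    using ba_run[of "Suc p'" q t] that up p' pq by auto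
  have r3: "ba t \<and> \<not> ab t \<and> \<not> down t" if "q' < t" "t \<le> N" for t
    using ba_run[of "Suc q'" "Suc N" t] that up q' pq by auto
  have c: "(down t \<longleftrightarrow> t = p' \<or> t = q') \<and> (ba t \<longleftrightarrow> t < p \<or> p' < t \<and> t < q \<or> q' < t) \<and>
      (ab t \<longleftrightarrow> p \<le> t \<and> t < p' \<or> q \<le> t \<and> t < q')" if t: "t \<le> N" for t
  proof -
    consider "t < p" | "p \<le> t" "t < p'" | "t = p'" | "p' < t" "t < q"
      | "q \<le> t" "t < q'" | "t = q'" | "q' < t" by arith
    then show ?thesis
      by cases (use r1[of t] r2[of t] r3[of t] p'(1,3,4) p'(5,6)[of t] q'(1,3,4) q'(5,6)[of t]
        p'q pq t in auto)
  qed
  show thesis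
  proof (rule that[of p' q'])
  qed (use p'(1) p'q q'(1,2) c in blast)+
qed

end

text \<open>Positions of the two matched edges that enter the zigzag \<open>I\<close> from above. The shifts turn the interlacing
  condition of \<open>two_particles\<close> into the nesting of the partitions.\<close>

definition lower :: "(nat \<Rightarrow> nat) \<times> (nat \<Rightarrow> nat) \<Rightarrow> nat \<Rightarrow> nat" where
  "lower f I = (if I = 0 then 0 else snd f (I - 1))"

definition upper :: "(nat \<Rightarrow> nat) \<times> (nat \<Rightarrow> nat) \<Rightarrow> nat \<Rightarrow> nat" where
  "upper f I = Suc (fst f I)"

definition BA_matched :: "(nat \<Rightarrow> nat) \<times> (nat \<Rightarrow> nat) \<Rightarrow> nat \<Rightarrow> nat \<Rightarrow> bool" where
  "BA_matched f I t \<longleftrightarrow> t < lower f I \<or> lower f (Suc I) < t \<and> t < upper f I \<or> upper f (Suc I) < t"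

definition AB_matched :: "(nat \<Rightarrow> nat) \<times> (nat \<Rightarrow> nat) \<Rightarrow> nat \<Rightarrow> nat \<Rightarrow> bool" where
  "AB_matched f I t \<longleftrightarrow> lower f I \<le> t \<and> t < lower f (Suc I) \<or> upper f I \<le> t \<and> t < upper f (Suc I)"

definition occupied :: "(nat \<Rightarrow> nat) \<times> (nat \<Rightarrow> nat) \<Rightarrow> nat \<Rightarrow> nat \<Rightarrow> bool" where
  "occupied f I t \<longleftrightarrow> t = lower f I \<or> t = upper f I"

lemma lower_upper_chain:
  assumes "f \<in> chain_pairs m n n"
  shows "lower f 0 = 0" "upper f 0 = 1" "lower f (Suc 0) = 0"
    "lower f I \<le> lower f (Suc I)" "lower f (Suc I) < upper f I" "upper f I \<le> upper f (Suc I)"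
    "lower f I \<le> n" "upper f I \<le> Suc n"
    "m < I \<Longrightarrow> upper f I = Suc n" "Suc m < I \<Longrightarrow> lower f I = n"
proof -
  have f: "fst f 0 = 0" "snd f 0 = 0" "fst f i \<le> fst f (Suc i)" "snd f i \<le> snd f (Suc i)"
    "m < i \<Longrightarrow> fst f i = n \<and> snd f i = n" for i
    using assms unfolding chain_pairs_def by (simp_all add: split_beta)
  note le = chain_pairs_le[OF assms]
  show "lower f 0 = 0" "upper f 0 = 1" "lower f (Suc 0) = 0"
    by (simp_all add: lower_def upper_def f(1,2))
  show "lower f I \<le> lower f (Suc I)" using f(4)[of "I - 1"] by (cases I) (simp_all add: lower_def)
  show "lower f (Suc I) < upper f I" "upper f I \<le> upper f (Suc I)" "upper f I \<le> Suc n" "lower f I \<le> n"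
    using le[of I] le[of "I - 1"] f(3)[of I] by (simp_all add: lower_def upper_def)
  show "upper f I = Suc n" if "m < I" using f(5)[OF that] by (simp add: upper_def)
  show "lower f I = n" if "Suc m < I" using f(5)[of "I - 1"] that by (simp add: lower_def)
qed

text \<open>Together with \<open>exactly_one_A\<close> the converse of \<open>two_particles\<close>:
  the interlacing inequalities suffice for the local conditions along a zigzag.\<close>

lemma exactly_one_B:
  assumes "f \<in> chain_pairs m n n" "t \<le> Suc n"
  shows "exactly_one (BA_matched f I t) (0 < t \<and> AB_matched f I (t - 1)) (occupied f I t)"
  using lower_upper_chain(4-8)[OF assms(1), of I] lower_upper_chain(4-8)[OF assms(1), of "Suc I"]
  unfolding exactly_one_def BA_matched_def AB_matched_def occupied_def by linarith

lemma exactly_one_A: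
  assumes "f \<in> chain_pairs m n n" "t \<le> Suc n"
  shows "exactly_one (BA_matched f I t) (AB_matched f I t) (occupied f (Suc I) t)"
  using lower_upper_chain(4-8)[OF assms(1), of I] lower_upper_chain(4-8)[OF assms(1), of "Suc I"]
  unfolding exactly_one_def BA_matched_def AB_matched_def occupied_def by linarith

text \<open>The exits of one zigzag are the entries of the next. Besides the prescribed end rows,
  interlacing forces the lower particle to stay at \<open>0\<close> in the row \<open>1\<close> and
  the upper one to be at \<open>Suc n\<close> already in the row \<open>Suc m\<close>; this leaves
  \<open>m\<close> free positions for each particle, the parts of the two partitions.\<close>

lemma strip_chain:
  assumes zig: "\<And>I. I \<le> Suc m \<Longrightarrow> zigzag (Suc n) (up I) (up (Suc I)) (ba I) (ab I)"
    and first: "\<And>t. t \<le> Suc n \<Longrightarrow> up 0 t \<longleftrightarrow> t = 0 \<or> t = 1"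
    and last: "\<And>t. t \<le> Suc n \<Longrightarrow> up (Suc (Suc m)) t \<longleftrightarrow> t = n \<or> t = Suc n"
  obtains f where "f \<in> chain_pairs m n n"
    "\<And>I t. I \<le> Suc (Suc m) \<Longrightarrow> t \<le> Suc n \<Longrightarrow> up I t \<longleftrightarrow> occupied f I t"
    "\<And>I t. I \<le> Suc m \<Longrightarrow> t \<le> Suc n \<Longrightarrow> ba I t \<longleftrightarrow> BA_matched f I t"
    "\<And>I t. I \<le> Suc m \<Longrightarrow> t \<le> Suc n \<Longrightarrow> ab I t \<longleftrightarrow> AB_matched f I t"
proof -
  define P where "P I p q \<longleftrightarrow> p < q \<and> q \<le> Suc n \<and> (\<forall>t\<le>Suc n. up I t \<longleftrightarrow> t = p \<or> t = q)" for I p q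
  have P_unique: "p = p' \<and> q = q'" if "P I p q" "P I p' q'" for I p q p' q'
  proof -
    have "p < q" "q \<le> Suc n" "p' < q'" "q' \<le> Suc n"
      and *: "\<And>t. t \<le> Suc n \<Longrightarrow> (t = p \<or> t = q) = (t = p' \<or> t = q')"
      using that by (auto simp: P_def)
    then show ?thesis using *[of p] *[of q] *[of p'] by auto
  qed
  have step: "\<exists>p' q'. P (Suc I) p' q' \<and> p \<le> p' \<and> p' < q \<and> q \<le> q' \<and>
      (\<forall>t\<le>Suc n. ba I t \<longleftrightarrow> t < p \<or> p' < t \<and> t < q \<or> q' < t) \<and>
      (\<forall>t\<le>Suc n. ab I t \<longleftrightarrow> p \<le> t \<and> t < p' \<or> q \<le> t \<and> t < q')"
    if "I \<le> Suc m" "P I p q" for I p q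
  proof -
    interpret zigzag "Suc n" "up I" "up (Suc I)" "ba I" "ab I" by (rule zig[OF that(1)])
    have "\<And>t. t \<le> Suc n \<Longrightarrow> up I t \<longleftrightarrow> t = p \<or> t = q" "p < q" "q \<le> Suc n"
      using that(2) by (auto simp: P_def)
    then obtain p' q' where *: "p \<le> p'" "p' < q" "q \<le> q'" "q' \<le> Suc n"
      "\<And>t. t \<le> Suc n \<Longrightarrow> up (Suc I) t \<longleftrightarrow> t = p' \<or> t = q'"
      "\<And>t. t \<le> Suc n \<Longrightarrow> ba I t \<longleftrightarrow> t < p \<or> p' < t \<and> t < q \<or> q' < t"
      "\<And>t. t \<le> Suc n \<Longrightarrow> ab I t \<longleftrightarrow> p \<le> t \<and> t < p' \<or> q \<le> t \<and> t < q'"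
      using two_particles[of p q] by blast
    then have "P (Suc I) p' q'" by (auto simp: P_def)
    with * show ?thesis by blast
  qed
  have P0: "P 0 0 1" using first by (auto simp: P_def)
  have ex: "\<exists>p q. P I p q" if "I \<le> Suc (Suc m)" for I
    using that
  proof (induction I)
    case 0 then show ?case using P0 by blast
  next
    case (Suc I) then show ?case using step[of I] by fastforce
  qed
  have Pm: "P (Suc (Suc m)) n (Suc n)" using last by (auto simp: P_def)
  define p where "p I = (if I \<le> Suc (Suc m) then (SOME p. \<exists>q. P I p q) else n)" for I
  define q where "q I = (if I \<le> Suc (Suc m) then (SOME q. P I (p I) q) else Suc n)" for I
  have Ppq: "P I (p I) (q I)" if "I \<le> Suc (Suc m)" for I
    using someI_ex[OF ex[OF that]] someI_ex[of "P I (p I)"] that by (auto simp: p_def q_def)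
  have steps: "p I \<le> p (Suc I)" "p (Suc I) < q I" "q I \<le> q (Suc I)"
      "\<And>t. t \<le> Suc n \<Longrightarrow> ba I t \<longleftrightarrow> t < p I \<or> p (Suc I) < t \<and> t < q I \<or> q (Suc I) < t"
      "\<And>t. t \<le> Suc n \<Longrightarrow> ab I t \<longleftrightarrow> p I \<le> t \<and> t < p (Suc I) \<or> q I \<le> t \<and> t < q (Suc I)"
    if I: "I \<le> Suc m" for I
  proof -
    obtain p' q' where *: "P (Suc I) p' q'" "p I \<le> p'" "p' < q I" "q I \<le> q'"
      "(\<forall>t\<le>Suc n. ba I t \<longleftrightarrow> t < p I \<or> p' < t \<and> t < q I \<or> q' < t)"
      "(\<forall>t\<le>Suc n. ab I t \<longleftrightarrow> p I \<le> t \<and> t < p' \<or> q I \<le> t \<and> t < q')"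
      using step[OF I Ppq] I by auto
    have "p' = p (Suc I)" "q' = q (Suc I)" using P_unique[OF *(1) Ppq] I by auto
    with * show "p I \<le> p (Suc I)" "p (Suc I) < q I" "q I \<le> q (Suc I)"
      "\<And>t. t \<le> Suc n \<Longrightarrow> ba I t \<longleftrightarrow> t < p I \<or> p (Suc I) < t \<and> t < q I \<or> q (Suc I) < t"
      "\<And>t. t \<le> Suc n \<Longrightarrow> ab I t \<longleftrightarrow> p I \<le> t \<and> t < p (Suc I) \<or> q I \<le> t \<and> t < q (Suc I)"
      by auto
  qed
  have p0: "p 0 = 0" "q 0 = 1" using P_unique[OF Ppq[of 0] P0] by auto
  have pm: "p (Suc (Suc m)) = n" "q (Suc (Suc m)) = Suc n" using P_unique[OF Ppq Pm] by auto
  have qm: "q (Suc m) = Suc n" using steps(2,3)[of "Suc m"] pm by auto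
  have p1: "p (Suc 0) = 0" using steps(1,2)[of 0] p0 by auto
  have big: "p I = n" "q I = Suc n" if "Suc (Suc m) \<le> I" for I
    using pm that by (auto simp: p_def q_def le_Suc_eq)
  have mono: "p I \<le> p (Suc I)" "p (Suc I) < q I" "q I \<le> q (Suc I)" for I
    using steps(1-3)[of I] big[of I] big[of "Suc I"] by (cases "I \<le> Suc m"; auto)+
  define f where "f = (\<lambda>i. q i - 1, \<lambda>i. p (Suc i))"
  have q_pos: "0 < q I" for I using mono(2)[of I] by auto
  have f: "f \<in> chain_pairs m n n"
    unfolding chain_pairs_def f_def
  proof (clarsimp, intro conjI allI impI)
    show "q 0 \<le> Suc 0" "p (Suc 0) = 0" using p0 p1 by auto
    fix i
    show "q i - Suc 0 \<le> q (Suc i) - Suc 0" "p (Suc i) \<le> p (Suc (Suc i))" "p (Suc i) \<le> q i - Suc 0"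
      using mono[of i] mono[of "Suc i"] by auto
    assume "m < i"
    then have "i = Suc m \<or> Suc (Suc m) \<le> i" by auto
    then show "q i - Suc 0 = n" "p (Suc i) = n"
      using qm big pm by auto
  qed
  have lower: "lower f I = p I" for I using p0 by (cases I) (auto simp: lower_def f_def)
  have upper: "upper f I = q I" for I using q_pos[of I] by (auto simp: upper_def f_def)
  show thesis
  proof (rule that[OF f])
    fix I t assume "I \<le> Suc (Suc m)" "t \<le> Suc n"
    then show "up I t \<longleftrightarrow> occupied f I t" using Ppq[of I] by (simp add: P_def occupied_def lower upper)
  qed (simp_all add: BA_matched_def AB_matched_def lower upper steps)
qed

section \<open>The flake\<close>

text \<open>The vertex \<open>t\<close> of each kind in the zigzag \<open>I\<close>, which lies between the cells \<open>c\<close> with \<open>fst c = I - 1\<close> and those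
  with \<open>fst c = I\<close>.\<close>

definition vertex_A :: "nat \<Rightarrow> nat \<Rightarrow> point" where
  "vertex_A I t = (3 * int I - 1, 3 * int t + 3 * int I - 5)"

definition vertex_B :: "nat \<Rightarrow> nat \<Rightarrow> point" where
  "vertex_B I t = (3 * int I - 2, 3 * int t + 3 * int I - 7)"

definition strip_cell :: "nat \<Rightarrow> nat \<Rightarrow> int \<times> int" where
  "strip_cell H t = (int H, int t + int H - 1)"

definition edge_BA :: "nat \<Rightarrow> nat \<Rightarrow> point set" where "edge_BA I t = {vertex_B I t, vertex_A I t}"
definition edge_AB :: "nat \<Rightarrow> nat \<Rightarrow> point set" where "edge_AB I t = {vertex_A I t, vertex_B I (Suc t)}"
definition edge_V :: "nat \<Rightarrow> nat \<Rightarrow> point set" where "edge_V I t = {vertex_A I t, vertex_B (Suc I) t}"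

lemma vertex_inj [simp]:
  "vertex_A I t = vertex_A J s \<longleftrightarrow> I = J \<and> t = s" "vertex_B I t = vertex_B J s \<longleftrightarrow> I = J \<and> t = s"
  "vertex_A I t \<noteq> vertex_B J s" "vertex_B J s \<noteq> vertex_A I t"
proof -
  show "vertex_A I t \<noteq> vertex_B J s" unfolding vertex_A_def vertex_B_def prod.inject by presburger
  then show "vertex_B J s \<noteq> vertex_A I t" by metis
qed (auto simp: vertex_A_def vertex_B_def)

lemma strip_cell_inj [simp]: "strip_cell H t = strip_cell J s \<longleftrightarrow> H = J \<and> t = s"
  by (auto simp: strip_cell_def)

lemma mem_edge [simp]:
  "vertex_A J s \<in> edge_BA I t \<longleftrightarrow> J = I \<and> s = t" "vertex_B J s \<in> edge_BA I t \<longleftrightarrow> J = I \<and> s = t"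
  "vertex_A J s \<in> edge_AB I t \<longleftrightarrow> J = I \<and> s = t" "vertex_B J s \<in> edge_AB I t \<longleftrightarrow> J = I \<and> s = Suc t"
  "vertex_A J s \<in> edge_V I t \<longleftrightarrow> J = I \<and> s = t" "vertex_B J s \<in> edge_V I t \<longleftrightarrow> J = Suc I \<and> s = t"
  by (simp_all add: edge_BA_def edge_AB_def edge_V_def)

lemma edge_inj [simp]:
  "edge_BA I t = edge_BA J s \<longleftrightarrow> I = J \<and> t = s" "edge_AB I t = edge_AB J s \<longleftrightarrow> I = J \<and> t = s"
  "edge_V I t = edge_V J s \<longleftrightarrow> I = J \<and> t = s"
  "edge_BA I t \<noteq> edge_AB J s" "edge_BA I t \<noteq> edge_V J s" "edge_AB I t \<noteq> edge_V J s"
  "edge_AB I t \<noteq> edge_BA J s" "edge_V I t \<noteq> edge_BA J s" "edge_V I t \<noteq> edge_AB J s"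
  by (auto simp: edge_BA_def edge_AB_def edge_V_def doubleton_eq_iff)

lemma hexagon_strip_cell:
  "gverts (hexagon (strip_cell H t)) =
     {vertex_A (Suc H) t, vertex_B (Suc H) (Suc t), vertex_A H (Suc t), vertex_B H (Suc t), vertex_A H t, vertex_B (Suc H) t}"
  "odd_edges (strip_cell H t) = {edge_V H (Suc t), edge_AB H t, edge_BA (Suc H) t}"
  "even_edges (strip_cell H t) = {edge_AB (Suc H) t, edge_BA H (Suc t), edge_V H t}"
  by (simp_all add: strip_cell_def gverts_hexagon_eq odd_edges_eq even_edges_eq edge_BA_def edge_AB_def edge_V_def
      vertex_A_def vertex_B_def insert_commute algebra_simps)

lemma ex1_iff_exactly_one:
  assumes "e1 \<noteq> e2" "e1 \<noteq> e3" "e2 \<noteq> e3"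
    and "\<And>e. e \<in> M \<and> v \<in> e \<longleftrightarrow> (P1 \<and> e = e1) \<or> (P2 \<and> e = e2) \<or> (P3 \<and> e = e3)"
  shows "(\<exists>!e. e \<in> M \<and> v \<in> e) \<longleftrightarrow> exactly_one P1 P2 P3"
  unfolding assms(4) exactly_one_def using assms(1-3) by (cases P1; cases P2; cases P3; simp; blast)

locale flake2 =
  fixes m n :: nat
  assumes pos: "0 < m" "0 < n"
begin

text \<open>In these coordinates the flake is the parallelogram of the cells \<open>(H, t)\<close> with \<open>H \<le> m\<close> and \<open>t \<le> n\<close>,
  without its two opposite corner cells \<open>(0, 0)\<close> and \<open>(m, n)\<close>.\<close>

definition inA :: "nat \<Rightarrow> nat \<Rightarrow> bool" where
  "inA I t \<longleftrightarrow> I \<le> Suc m \<and> t \<le> Suc n \<and> \<not> (I = 0 \<and> t = 0) \<and> \<not> (I = m \<and> t = Suc n) \<and>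
     \<not> (I = Suc m \<and> n \<le> t)"

definition inB :: "nat \<Rightarrow> nat \<Rightarrow> bool" where
  "inB I t \<longleftrightarrow> I \<le> Suc m \<and> t \<le> Suc n \<and> \<not> (I = Suc m \<and> t = Suc n) \<and> \<not> (I = 1 \<and> t = 0) \<and>
     \<not> (I = 0 \<and> t \<le> 1)"

definition inH :: "nat \<Rightarrow> nat \<Rightarrow> bool" where
  "inH H t \<longleftrightarrow> H \<le> m \<and> t \<le> n \<and> \<not> (H = 0 \<and> t = 0) \<and> \<not> (H = m \<and> t = n)"

definition okBA where "okBA I t \<longleftrightarrow> inA I t \<and> inB I t"
definition okAB where "okAB I t \<longleftrightarrow> inA I t \<and> inB I (Suc t)"
definition okV where "okV I t \<longleftrightarrow> inA I t \<and> inB (Suc I) t"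

text \<open>Compares the explicit bounds with membership in a cell. In particular, a lattice edge
  with both ends in the flake lies on one of its cells.\<close>

lemma in_iff:
  "inA I t \<longleftrightarrow> inH I t \<or> (\<exists>u. t = Suc u \<and> inH I u) \<or> (\<exists>J. I = Suc J \<and> inH J t)"
  "inB I t \<longleftrightarrow> (\<exists>J u. I = Suc J \<and> t = Suc u \<and> inH J u) \<or>
     (\<exists>u. t = Suc u \<and> inH I u) \<or> (\<exists>J. I = Suc J \<and> inH J t)"
  "okBA I t \<longleftrightarrow> (\<exists>u. t = Suc u \<and> inH I u) \<or> (\<exists>J. I = Suc J \<and> inH J t)"
  "okAB I t \<longleftrightarrow> inH I t \<or> (\<exists>J. I = Suc J \<and> inH J t)"
  "okV I t \<longleftrightarrow> inH I t \<or> (\<exists>u. t = Suc u \<and> inH I u)"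
  using pos by (cases I; cases t; auto simp: inA_def inB_def inH_def okBA_def okAB_def okV_def)+

definition flake :: graph where "flake = hexagonal_flake 2 m n"

text \<open>The cells with \<open>a = 0\<close> have \<open>H < m\<close> and
  \<open>1 \<le> t \<le> n\<close>, those with \<open>a = 1\<close> have
  \<open>1 \<le> H \<le> m\<close> and \<open>t < n\<close>; these two parallelograms miss exactly
  the two opposite corners.\<close>

lemma flake_cells_eq: "flake_cells 2 m n = {strip_cell H t | H t. inH H t}"
proof (intro set_eqI iffI)
  fix c assume "c \<in> flake_cells 2 m n"
  then obtain a b c' where abc: "c = (a + b, b + c')" "0 \<le> a" "a < 2" "0 \<le> b" "b < int m" "0 \<le> c'" "c' < int n"
    by (auto simp: flake_cells_def)
  have "c = strip_cell (nat (a + b)) (nat (c' - a + 1)) \<and> inH (nat (a + b)) (nat (c' - a + 1))"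
    using abc by (auto simp: strip_cell_def inH_def)
  then show "c \<in> {strip_cell H t | H t. inH H t}" by blast
next
  fix c assume "c \<in> {strip_cell H t | H t. inH H t}"
  then obtain H t where c: "c = strip_cell H t" and H: "inH H t" by blast
  show "c \<in> flake_cells 2 m n"
  \<comment> \<open>\<open>a = 0\<close> is chosen unless it would give \<open>b = m\<close> or
    \<open>c = -1\<close>; then \<open>a = 1\<close> works, because the corner cells are
    excluded.\<close>
  proof (cases "H < m \<and> 0 < t")
    case True
    then have "c = (0 + int H, int H + (int t - 1)) \<and> 0 \<le> (0::int) \<and> 0 < int 2 \<and> 0 \<le> int H \<and> int H < int m
        \<and> 0 \<le> int t - 1 \<and> int t - 1 < int n"
      using c H by (auto simp: strip_cell_def inH_def)
    then show ?thesis unfolding flake_cells_def by blast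
  next
    case False
    then have "c = (1 + (int H - 1), (int H - 1) + int t) \<and> 0 \<le> (1::int) \<and> 1 < int 2 \<and> 0 \<le> int H - 1
        \<and> int H - 1 < int m \<and> 0 \<le> int t \<and> int t < int n"
      using c H pos by (auto simp: strip_cell_def inH_def)
    then show ?thesis unfolding flake_cells_def by blast
  qed
qed

lemma gverts_flake: "v \<in> gverts flake \<longleftrightarrow> (\<exists>I t. v = vertex_A I t \<and> inA I t) \<or> (\<exists>I t. v = vertex_B I t \<and> inB I t)"
proof -
  have "gverts flake = (\<Union>c\<in>{strip_cell H t | H t. inH H t}. gverts (hexagon c))"
    by (simp add: flake_def hexagonal_flake_def cells_graph_def flake_cells_eq)
  then have "v \<in> gverts flake \<longleftrightarrow> (\<exists>H t. inH H t \<and> v \<in> gverts (hexagon (strip_cell H t)))" by blast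
  then show ?thesis unfolding hexagon_strip_cell in_iff by blast
qed

lemma gedges_flake: "e \<in> gedges flake \<longleftrightarrow> (\<exists>I t. e = edge_BA I t \<and> okBA I t) \<or>
   (\<exists>I t. e = edge_AB I t \<and> okAB I t) \<or> (\<exists>I t. e = edge_V I t \<and> okV I t)"
proof -
  have "gedges flake = (\<Union>c\<in>{strip_cell H t | H t. inH H t}. gedges (hexagon c))"
    by (simp add: flake_def hexagonal_flake_def cells_graph_def flake_cells_eq)
  then have "e \<in> gedges flake \<longleftrightarrow> (\<exists>H t. inH H t \<and> e \<in> gedges (hexagon (strip_cell H t)))" by blast
  then show ?thesis unfolding gedges_hexagon hexagon_strip_cell in_iff by blast
qed

lemma edge_mem_flake [simp]:
  "edge_BA I t \<in> gedges flake \<longleftrightarrow> okBA I t" "edge_AB I t \<in> gedges flake \<longleftrightarrow> okAB I t" "edge_V I t \<in> gedges flake \<longleftrightarrow> okV I t"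
  by (simp_all add: gedges_flake)

text \<open>The odd edges meet all six corners, so these are vertices of the flake. Corner
  \<open>4\<close> is not of kind B by its first coordinate modulo 3, hence of kind A, and fixes
  \<open>H\<close> and \<open>t\<close>; the bounds for the three A corners then exclude every cell
  outside.\<close>

lemma hexagon_in_flake:
  assumes "odd_edges c \<subseteq> gedges flake"
  obtains H t where "c = strip_cell H t" "inH H t"
proof -
  have V: "v \<in> gverts flake" if v: "v \<in> gverts (hexagon c)" for v
  proof -
    obtain e where "e \<in> odd_edges c" "v \<in> e" using ex_odd_edge[OF v] by blast
    then have "e \<in> gedges flake" "v \<in> e" using assms by blast+
    then show ?thesis
      unfolding gedges_flake gverts_flake okBA_def okAB_def okV_def edge_BA_def edge_AB_def edge_V_def by blast
  qed
  obtain i j where c: "c = (i, j)" by (cases c)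
  have "(3 * i - 1, 3 * j - 2) \<in> gverts flake"
    by (rule V) (simp add: c gverts_hexagon_eq)
  moreover have "(3 * i - 1, 3 * j - 2) \<noteq> vertex_B I t" for I t
    unfolding vertex_B_def prod.inject by presburger
  ultimately obtain H t where "(3 * i - 1, 3 * j - 2) = vertex_A H t"
    unfolding gverts_flake by blast
  then have strip_cell: "c = strip_cell H t" by (auto simp: c strip_cell_def vertex_A_def)
  have "vertex_A (Suc H) t \<in> gverts flake" "vertex_A H (Suc t) \<in> gverts flake" "vertex_A H t \<in> gverts flake"
    by (rule V; simp add: strip_cell hexagon_strip_cell)+
  then have "inA (Suc H) t" "inA H (Suc t)" "inA H t"
    by (simp_all add: gverts_flake)
  then have "inH H t" by (auto simp: inA_def inH_def)
  with strip_cell that show thesis by blast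
qed

sublocale sextet_closed "flake_cells 2 m n"
proof
  have "{strip_cell H t | H t. inH H t} \<subseteq> (\<lambda>(H, t). strip_cell H t) ` ({..m} \<times> {..n})"
    by (auto simp: inH_def)
  then show "finite (flake_cells 2 m n)"
    unfolding flake_cells_eq by (rule finite_subset) simp
  fix c assume "odd_edges c \<subseteq> gedges (cells_graph (flake_cells 2 m n))"
  then have "odd_edges c \<subseteq> gedges flake" by (simp add: flake_def hexagonal_flake_def)
  then show "c \<in> flake_cells 2 m n"
    using hexagon_in_flake unfolding flake_cells_eq by blast
qed

lemma perfect_matching_iff:
  assumes "M \<subseteq> gedges flake"
  shows "M \<in> perfect_matchings flake \<longleftrightarrow>
    (\<forall>I t. inA I t \<longrightarrow> exactly_one (edge_BA I t \<in> M) (edge_AB I t \<in> M) (edge_V I t \<in> M)) \<and>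
    (\<forall>I t. inB I t \<longrightarrow> exactly_one (edge_BA I t \<in> M) (0 < t \<and> edge_AB I (t - 1) \<in> M) (0 < I \<and> edge_V (I - 1) t \<in> M))"
proof -
  have A: "(\<exists>!e. e \<in> M \<and> vertex_A I t \<in> e) \<longleftrightarrow> exactly_one (edge_BA I t \<in> M) (edge_AB I t \<in> M) (edge_V I t \<in> M)" for I t
  proof (rule ex1_iff_exactly_one)
    fix e
    have "e \<in> M \<and> vertex_A I t \<in> e \<longrightarrow> e = edge_BA I t \<or> e = edge_AB I t \<or> e = edge_V I t"
      using assms gedges_flake[of e] by auto
    moreover have "vertex_A I t \<in> edge_BA I t" "vertex_A I t \<in> edge_AB I t" "vertex_A I t \<in> edge_V I t" by simp_all
    ultimately show "e \<in> M \<and> vertex_A I t \<in> e \<longleftrightarrow> (edge_BA I t \<in> M \<and> e = edge_BA I t) \<or> (edge_AB I t \<in> M \<and> e = edge_AB I t)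
        \<or> (edge_V I t \<in> M \<and> e = edge_V I t)" by blast
  qed simp_all
  have B: "(\<exists>!e. e \<in> M \<and> vertex_B I t \<in> e) \<longleftrightarrow>
      exactly_one (edge_BA I t \<in> M) (0 < t \<and> edge_AB I (t - 1) \<in> M) (0 < I \<and> edge_V (I - 1) t \<in> M)" for I t
  proof (rule ex1_iff_exactly_one)
    fix e
    have "e \<in> M \<and> vertex_B I t \<in> e \<longrightarrow> e = edge_BA I t \<or> 0 < t \<and> e = edge_AB I (t - 1) \<or> 0 < I \<and> e = edge_V (I - 1) t"
      using assms gedges_flake[of e] by auto
    moreover have "vertex_B I t \<in> edge_BA I t" "0 < t \<Longrightarrow> vertex_B I t \<in> edge_AB I (t - 1)" "0 < I \<Longrightarrow> vertex_B I t \<in> edge_V (I - 1) t"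
      by simp_all
    ultimately show "e \<in> M \<and> vertex_B I t \<in> e \<longleftrightarrow> (edge_BA I t \<in> M \<and> e = edge_BA I t) \<or>
        ((0 < t \<and> edge_AB I (t - 1) \<in> M) \<and> e = edge_AB I (t - 1)) \<or>
        ((0 < I \<and> edge_V (I - 1) t \<in> M) \<and> e = edge_V (I - 1) t)" by blast
  qed simp_all
  have V: "(\<forall>v\<in>gverts flake. P v) \<longleftrightarrow> (\<forall>I t. inA I t \<longrightarrow> P (vertex_A I t)) \<and> (\<forall>I t. inB I t \<longrightarrow> P (vertex_B I t))" for P
    unfolding Ball_def gverts_flake by blast
  show ?thesis
    unfolding perfect_matchings_def mem_Collect_eq V A B by (simp only: assms simp_thms)
qed

definition matching_of :: "(nat \<Rightarrow> nat) \<times> (nat \<Rightarrow> nat) \<Rightarrow> point set set" where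
  "matching_of f = {edge_BA I t | I t. okBA I t \<and> BA_matched f I t} \<union> {edge_AB I t | I t. okAB I t \<and> AB_matched f I t} \<union>
     {edge_V I t | I t. okV I t \<and> occupied f (Suc I) t}"

lemma mem_matching_of [simp]:
  "edge_BA I t \<in> matching_of f \<longleftrightarrow> okBA I t \<and> BA_matched f I t"
  "edge_AB I t \<in> matching_of f \<longleftrightarrow> okAB I t \<and> AB_matched f I t"
  "edge_V I t \<in> matching_of f \<longleftrightarrow> okV I t \<and> occupied f (Suc I) t"
  by (auto simp: matching_of_def)

lemma matching_of_subset: "matching_of f \<subseteq> gedges flake"
  unfolding matching_of_def by auto

lemma occupied_boundary:
  assumes "f \<in> chain_pairs m n n"
  shows "occupied f 0 t \<longleftrightarrow> t = 0 \<or> t = 1" "occupied f (Suc 0) 0" "occupied f (Suc m) (Suc n)"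
    "occupied f (Suc (Suc m)) t \<longleftrightarrow> t = n \<or> t = Suc n"
  using lower_upper_chain[OF assms] by (simp_all add: occupied_def)

text \<open>The local conditions hold in the whole strip. It remains to see that an edge matched at
  a vertex of the flake never leads to a vertex that was cut off; the boundary positions and the
  range of \<open>f\<close> rule this out.\<close>

lemma matching_of_perfect:
  assumes f: "f \<in> chain_pairs m n n"
  shows "matching_of f \<in> perfect_matchings flake"
  unfolding perfect_matching_iff[OF matching_of_subset] mem_matching_of
proof (intro conjI allI impI)
  note b = occupied_boundary[OF f]
  note z = lower_upper_chain(1-3)[OF f]
  fix I t
  {
    assume A: "inA I t"
    then have t: "t \<le> Suc n" by (simp add: inA_def)
    note o = exactly_one_A[OF f t, of I]
    have "BA_matched f I t \<Longrightarrow> inB I t"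
      using A lower_upper_chain(4-8)[OF f, of 0] z by (auto simp: BA_matched_def inA_def inB_def)
    moreover have "AB_matched f I t \<Longrightarrow> inB I (Suc t)"
      using A lower_upper_chain(7,8)[OF f, of "Suc I"] by (auto simp: AB_matched_def inA_def inB_def)
    moreover have "occupied f (Suc I) t \<Longrightarrow> inB (Suc I) t"
      using A b(4)[of t] by (cases "I = Suc m") (auto simp: inA_def inB_def)
    ultimately show "exactly_one (okBA I t \<and> BA_matched f I t) (okAB I t \<and> AB_matched f I t) (okV I t \<and> occupied f (Suc I) t)"
      using o A by (auto simp: exactly_one_def okBA_def okAB_def okV_def)
  next
    assume B: "inB I t"
    then have t: "t \<le> Suc n" by (simp add: inB_def)
    note o = exactly_one_B[OF f t, of I]
    have "BA_matched f I t \<Longrightarrow> inA I t"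
      using B lower_upper_chain(7,8)[OF f, of I] lower_upper_chain(9)[OF f, of "Suc m"] lower_upper_chain(9,10)[OF f, of "Suc (Suc m)"]
      by (auto simp: BA_matched_def inA_def inB_def)
    moreover have "0 < t \<Longrightarrow> AB_matched f I (t - 1) \<Longrightarrow> inA I (t - 1)"
      using B by (auto simp: inA_def inB_def)
    moreover have "occupied f I t \<Longrightarrow> 0 < I \<and> inA (I - 1) t"
      using B b(1)[of t] by (cases I) (auto simp: inA_def inB_def)
    ultimately show "exactly_one (okBA I t \<and> BA_matched f I t) (0 < t \<and> okAB I (t - 1) \<and> AB_matched f I (t - 1))
        (0 < I \<and> okV (I - 1) t \<and> occupied f (Suc (I - 1)) t)"
      using o B by (cases I; cases t; simp add: exactly_one_def okBA_def okAB_def okV_def; blast)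
  }
qed

end

context flake2
begin

lemma perfect_matching_chain:
  assumes M: "M \<in> perfect_matchings flake"
  obtains f where "f \<in> chain_pairs m n n" "M = matching_of f"
proof -
  have sub: "M \<subseteq> gedges flake" using M by (simp add: perfect_matchings_def)
  have A: "exactly_one (edge_BA I t \<in> M) (edge_AB I t \<in> M) (edge_V I t \<in> M)" if "inA I t" for I t
    using M that unfolding perfect_matching_iff[OF sub] by blast
  have B: "exactly_one (edge_BA I t \<in> M) (0 < t \<and> edge_AB I (t - 1) \<in> M) (0 < I \<and> edge_V (I - 1) t \<in> M)" if "inB I t" for I t
    using M that unfolding perfect_matching_iff[OF sub] by blast
  have ok: "edge_BA I t \<in> M \<Longrightarrow> okBA I t" "edge_AB I t \<in> M \<Longrightarrow> okAB I t" "edge_V I t \<in> M \<Longrightarrow> okV I t" for I t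
    using sub edge_mem_flake by blast+
  \<comment> \<open>Edges with an end point that was cut off count as matched, and fictitious edges keep two
    particles before the first and after the last zigzag.\<close>
  define up where "up R t \<longleftrightarrow> (if R = 0 then t \<le> 1 else if R = Suc (Suc m) then n \<le> t
    else edge_V (R - 1) t \<in> M \<or> (R = 1 \<and> t = 0) \<or> (R = Suc m \<and> t = Suc n))" for R t
  have zig: "zigzag (Suc n) (up I) (up (Suc I)) (\<lambda>t. edge_BA I t \<in> M) (\<lambda>t. edge_AB I t \<in> M)" if I: "I \<le> Suc m" for I
  proof
    fix t assume t: "t \<le> Suc n"
    show "exactly_one (edge_BA I t \<in> M) (0 < t \<and> edge_AB I (t - 1) \<in> M) (up I t)"
    proof (cases "inB I t")
      case True
      then have "up I t \<longleftrightarrow> 0 < I \<and> edge_V (I - 1) t \<in> M" by (auto simp: up_def inB_def)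
      then show ?thesis using B[OF True] by simp
    next
      case False
      then have "edge_BA I t \<notin> M" "\<not> (0 < t \<and> edge_AB I (t - 1) \<in> M)"
        using ok(1)[of I t] ok(2)[of I "t - 1"] by (auto simp: okBA_def okAB_def)
      moreover have "up I t" using False I t by (auto simp: up_def inB_def)
      ultimately show ?thesis by (simp add: exactly_one_def)
    qed
    show "exactly_one (edge_BA I t \<in> M) (edge_AB I t \<in> M) (up (Suc I) t)"
    proof (cases "inA I t")
      case True
      have "I = Suc m \<Longrightarrow> edge_V I t \<notin> M" using ok(3)[of I t] by (auto simp: okV_def inB_def)
      then have "up (Suc I) t \<longleftrightarrow> edge_V I t \<in> M" using True by (auto simp: up_def inA_def)
      then show ?thesis using A[OF True] by simp
    next
      case False
      then have "edge_BA I t \<notin> M" "edge_AB I t \<notin> M"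
        using ok(1,2)[of I t] by (auto simp: okBA_def okAB_def)
      moreover have "up (Suc I) t" using False I t pos by (auto simp: up_def inA_def)
      ultimately show ?thesis by (simp add: exactly_one_def)
    qed
  next
    show "edge_AB I (Suc n) \<notin> M" using ok(2)[of I "Suc n"] by (auto simp: okAB_def inB_def)
  qed
  have first: "up 0 t \<longleftrightarrow> t = 0 \<or> t = 1" for t by (auto simp: up_def)
  have last: "up (Suc (Suc m)) t \<longleftrightarrow> t = n \<or> t = Suc n" if "t \<le> Suc n" for t
    using that by (auto simp: up_def)
  obtain f where f: "f \<in> chain_pairs m n n"
    "\<And>I t. I \<le> Suc (Suc m) \<Longrightarrow> t \<le> Suc n \<Longrightarrow> up I t \<longleftrightarrow> occupied f I t"
    "\<And>I t. I \<le> Suc m \<Longrightarrow> t \<le> Suc n \<Longrightarrow> edge_BA I t \<in> M \<longleftrightarrow> BA_matched f I t"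
    "\<And>I t. I \<le> Suc m \<Longrightarrow> t \<le> Suc n \<Longrightarrow> edge_AB I t \<in> M \<longleftrightarrow> AB_matched f I t"
    using strip_chain[OF zig first last] by blast
  have up: "up (Suc I) t \<longleftrightarrow> edge_V I t \<in> M" if "okV I t" for I t
    using that by (auto simp: up_def okV_def inA_def inB_def)
  have bd: "I \<le> Suc m \<and> t \<le> Suc n" if "inA I t" for I t using that by (simp add: inA_def)
  have "e \<in> M \<longleftrightarrow> e \<in> matching_of f" if e: "e \<in> gedges flake" for e
  proof -
    consider I t where "e = edge_BA I t" "okBA I t" | I t where "e = edge_AB I t" "okAB I t"
      | I t where "e = edge_V I t" "okV I t" using e unfolding gedges_flake by blast
    then show ?thesis
    proof cases
      case (1 I t)
      then have "I \<le> Suc m" "t \<le> Suc n" using bd by (auto simp: okBA_def)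
      then show ?thesis using f(3)[of I t] 1 by simp
    next
      case (2 I t)
      then have "I \<le> Suc m" "t \<le> Suc n" using bd by (auto simp: okAB_def)
      then show ?thesis using f(4)[of I t] 2 by simp
    next
      case (3 I t)
      then have "Suc I \<le> Suc (Suc m)" "t \<le> Suc n" using bd by (auto simp: okV_def)
      then show ?thesis using f(2)[of "Suc I" t] up[OF 3(2)] 3 by simp
    qed
  qed
  then have "M = matching_of f" using sub matching_of_subset by blast
  with f(1) that show thesis by blast
qed

text \<open>The vertical edges determine \<open>f\<close>: with the prescribed boundary positions
  they give the two positions in every row, and \<open>lower < upper\<close> orders them.\<close>

lemma matching_of_inj:
  assumes f: "f \<in> chain_pairs m n n" and f': "f' \<in> chain_pairs m n n"
    and eq: "matching_of f = matching_of f'"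
  shows "f = f'"
proof -
  have occupied: "occupied f R t \<longleftrightarrow> occupied f' R t" for R t
  proof (cases "0 < R \<and> R \<le> Suc m")
    case True
    then obtain I where R: "R = Suc I" "I \<le> m" by (cases R) auto
    show ?thesis
    proof (cases "okV I t")
      case True
      then show ?thesis
        using mem_matching_of(3)[of I t f] mem_matching_of(3)[of I t f'] eq R by simp
    next
      case False
      then consider "Suc n < t" | "R = 1" "t = 0" | "R = Suc m" "t = Suc n"
        using R by (auto simp: okV_def inA_def inB_def)
      then show ?thesis
      proof cases
        case 1
        then show ?thesis using lower_upper_chain(7,8)[OF f, of R] lower_upper_chain(7,8)[OF f', of R]
          by (auto simp: occupied_def)
      qed (use occupied_boundary[OF f] occupied_boundary[OF f'] in simp_all)
    qed
  next
    case False
    then consider "R = 0" | "Suc m < R" by linarith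
    then show ?thesis
      using lower_upper_chain(1,2)[OF f] lower_upper_chain(1,2)[OF f'] lower_upper_chain(9,10)[OF f, of R]
        lower_upper_chain(9,10)[OF f', of R]
      by cases (auto simp: occupied_def)
  qed
  have lh: "lower f R = lower f' R \<and> upper f R = upper f' R" for R
  proof -
    have "lower f R < upper f R" "lower f' R < upper f' R"
      using lower_upper_chain(4,5)[OF f, of R] lower_upper_chain(4,5)[OF f', of R] by auto
    moreover have "{lower f R, upper f R} = {lower f' R, upper f' R}"
      using occupied[of R] by (auto simp: occupied_def)
    ultimately show ?thesis unfolding doubleton_eq_iff by linarith
  qed
  have "fst f i = fst f' i" for i using lh[of i] by (simp add: upper_def)
  moreover have "snd f i = snd f' i" for i using lh[of "Suc i"] by (simp add: lower_def)
  ultimately show ?thesis by (simp add: prod_eq_iff fun_eq_iff)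
qed

lemma bij_matching_of: "bij_betw matching_of (chain_pairs m n n) (perfect_matchings flake)"
  unfolding bij_betw_def
proof
  show "inj_on matching_of (chain_pairs m n n)" using matching_of_inj by (rule inj_onI)
  show "matching_of ` chain_pairs m n n = perfect_matchings flake"
    using matching_of_perfect perfect_matching_chain by blast
qed

text \<open>On \<open>edge_V H (Suc t)\<close> stands one of the two particles,
  \<open>edge_AB H t\<close> says that it has just moved right, so its part rose, and
  \<open>edge_BA (Suc H) t\<close> asks for vacuum at its left in the next zigzag. For the lower
  particle the last condition is automatic; for the upper one it means that the lower particle left
  that zigzag before \<open>t\<close>.\<close>

lemma sextets_matching_of:
  assumes f: "f \<in> chain_pairs m n n"
  shows "sextets (matching_of f) =
    (\<lambda>i. strip_cell (Suc i) (snd f (Suc i) - 1)) ` {i. i < m \<and> snd f i < snd f (Suc i)} \<union>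
    (\<lambda>i. strip_cell i (fst f (Suc i))) ` {i. i < m \<and> fst f i < fst f (Suc i) \<and> snd f (Suc i) < fst f (Suc i)}"
    (is "_ = ?S1 \<union> ?S2")
proof -
  have ok: "inH H t \<Longrightarrow> okV H (Suc t) \<and> okAB H t \<and> okBA (Suc H) t" for H t
    unfolding in_iff by blast
  have "c \<in> sextets (matching_of f) \<longleftrightarrow> (\<exists>H t. c = strip_cell H t \<and> inH H t \<and> occupied f (Suc H) (Suc t) \<and> AB_matched f H t
      \<and> BA_matched f (Suc H) t)" for c
  proof
    assume "c \<in> sextets (matching_of f)"
    then have c: "odd_edges c \<subseteq> matching_of f" by (simp add: sextets_def)
    then obtain H t where "c = strip_cell H t" "inH H t"
      using hexagon_in_flake[of c] matching_of_subset by blast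
    with c show "\<exists>H t. c = strip_cell H t \<and> inH H t \<and> occupied f (Suc H) (Suc t) \<and> AB_matched f H t \<and> BA_matched f (Suc H) t"
      by (auto simp: hexagon_strip_cell)
  qed (use ok in \<open>auto simp: sextets_def hexagon_strip_cell\<close>)
  moreover have "inH H t \<and> occupied f (Suc H) (Suc t) \<and> AB_matched f H t \<and> BA_matched f (Suc H) t \<longleftrightarrow>
      (\<exists>i<m. H = Suc i \<and> t = snd f (Suc i) - 1 \<and> snd f i < snd f (Suc i)) \<or>
      (\<exists>i<m. H = i \<and> t = fst f (Suc i) \<and> fst f i < fst f (Suc i) \<and> snd f (Suc i) < fst f (Suc i))" for H t
  proof -
    have s: "lower f (Suc j) = snd f j" "upper f j = Suc (fst f j)" for j by (simp_all add: lower_def upper_def)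
    have le: "snd f j \<le> snd f (Suc j)" "fst f j \<le> fst f (Suc j)" "snd f j \<le> fst f j" for j
      using lower_upper_chain(4)[OF f, of "Suc j"] lower_upper_chain(5,6)[OF f, of j] by (simp_all add: s)
    have z: "fst f 0 = 0" "snd f 0 = 0" "fst f (Suc m) = n"
      using lower_upper_chain(1-3)[OF f] lower_upper_chain(9)[OF f, of "Suc m"] by (simp_all add: s)
    have bound: "fst f j \<le> n" for j using lower_upper_chain(8)[OF f, of j] by (simp add: s)
    have occupied: "occupied f (Suc H) (Suc t) \<longleftrightarrow> Suc t = snd f H \<or> t = fst f (Suc H)"
      by (auto simp: occupied_def s)
    have AB_matched: "AB_matched f H t \<longleftrightarrow> lower f H \<le> t \<and> t < snd f H \<or> Suc (fst f H) \<le> t \<and> t \<le> fst f (Suc H)"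
      by (auto simp: AB_matched_def s)
    have BA_matched: "BA_matched f (Suc H) t \<longleftrightarrow> t < snd f H \<or> snd f (Suc H) < t \<and> t \<le> fst f (Suc H) \<or>
        Suc (fst f (Suc (Suc H))) < t"
      by (auto simp: BA_matched_def s)
    show ?thesis
    proof (intro iffI; (elim disjE)?)
      assume *: "inH H t \<and> occupied f (Suc H) (Suc t) \<and> AB_matched f H t \<and> BA_matched f (Suc H) t"
      from * consider "Suc t = snd f H" | "t = fst f (Suc H)" unfolding occupied by blast
      then show "(\<exists>i<m. H = Suc i \<and> t = snd f (Suc i) - 1 \<and> snd f i < snd f (Suc i)) \<or>
        (\<exists>i<m. H = i \<and> t = fst f (Suc i) \<and> fst f i < fst f (Suc i) \<and> snd f (Suc i) < fst f (Suc i))"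
      proof cases
        case 1
        then obtain i where i: "H = Suc i" using z by (cases H) auto
        then have "i < m" using * by (simp add: inH_def)
        moreover have "snd f i < snd f (Suc i)"
          using * 1 le(3)[of H] unfolding AB_matched by (auto simp: s i)
        ultimately show ?thesis using 1 i by auto
      next
        case 2
        \<comment> \<open>In the row \<open>H = m\<close> the position would be
          \<open>t = n\<close>, the cell that was cut off.\<close>
        then have "H < m" using * z by (cases "H = m") (auto simp: inH_def)
        moreover have "snd f H \<le> t" using 2 le(1,3)[of H] le(3)[of "Suc H"] by linarith
        then have "fst f H < fst f (Suc H)" "snd f (Suc H) < fst f (Suc H)"
          using * 2 le(2)[of "Suc H"] unfolding AB_matched BA_matched by linarith+
        ultimately show ?thesis using 2 by blast
      qed
    next
      assume "\<exists>i<m. H = Suc i \<and> t = snd f (Suc i) - 1 \<and> snd f i < snd f (Suc i)"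
      then obtain i where i: "i < m" "H = Suc i" "Suc t = snd f H" "snd f i < snd f H" by auto
      have "t < n" using i(3) le(3)[of H] bound[of H] by linarith
      then have "inH H t" using i by (simp add: inH_def)
      then show "inH H t \<and> occupied f (Suc H) (Suc t) \<and> AB_matched f H t \<and> BA_matched f (Suc H) t"
        unfolding occupied AB_matched BA_matched using i by (simp add: s)
    next
      assume "\<exists>i<m. H = i \<and> t = fst f (Suc i) \<and> fst f i < fst f (Suc i) \<and> snd f (Suc i) < fst f (Suc i)"
      then have i: "H < m" "t = fst f (Suc H)" "fst f H < t" "snd f (Suc H) < t" by auto
      then have "inH H t" using bound[of "Suc H"] by (simp add: inH_def)
      then show "inH H t \<and> occupied f (Suc H) (Suc t) \<and> AB_matched f H t \<and> BA_matched f (Suc H) t"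
        unfolding occupied AB_matched BA_matched using i by simp
    qed
  qed
  ultimately show ?thesis by (intro set_eqI) auto
qed

lemma card_sextets_matching_of:
  assumes f: "f \<in> chain_pairs m n n"
  shows "card (sextets (matching_of f)) = corners m f"
proof -
  let ?A = "{i. i < m \<and> snd f i < snd f (Suc i)}"
  let ?B = "{i. i < m \<and> fst f i < fst f (Suc i) \<and> snd f (Suc i) < fst f (Suc i)}"
  have "card (sextets (matching_of f)) = card ?A + card ?B"
    unfolding sextets_matching_of[OF f]
  proof (subst card_Un_disjoint)
    \<comment> \<open>A cell common to both families would give equality here.\<close>
    have "snd f (Suc i) - 1 < fst f (Suc (Suc i))" if "snd f i < snd f (Suc i)" for i
      using that lower_upper_chain(5,6)[OF f, of "Suc i"] by (auto simp: lower_def upper_def)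
    then show "(\<lambda>i. strip_cell (Suc i) (snd f (Suc i) - 1)) ` ?A \<inter> (\<lambda>i. strip_cell i (fst f (Suc i))) ` ?B = {}"
      by fastforce
  qed (simp_all add: card_image inj_on_def)
  also have "\<dots> = corners m f"
    unfolding corners_def split_beta sum.distrib
    by (simp add: sum_of_bool_eq Int_def)
  finally show ?thesis .
qed

lemma ZZ_flake: "ZZ_poly flake = path_det [:0, 1:] m n n"
proof -
  have "ZZ_poly flake = (\<Sum>M\<in>perfect_matchings flake. (1 + [:0, 1:]) ^ card (sextets M))"
    using ZZ_poly_eq by (simp only: flake_def hexagonal_flake_def)
  also have "\<dots> = (\<Sum>f\<in>chain_pairs m n n. (1 + [:0, 1:]) ^ card (sextets (matching_of f)))"
    by (rule sum.reindex_bij_betw[OF bij_matching_of, symmetric])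
  also have "\<dots> = chain_sum [:0, 1:] m n n"
    unfolding chain_sum_def by (intro sum.cong refl) (simp only: card_sextets_matching_of)
  finally show ?thesis by (simp add: chain_sum_eq_path_det)
qed

end

theorem theorem1p4:
  fixes m n :: nat
  assumes "m > 0" and "n > 0"
  shows "ZZ_poly (hexagonal_flake 2 m n) =
    det (vector [vector [J_poly m n, K_poly m n],
                 vector [K_poly n m, J_poly m n]] :: int poly ^ 2 ^ 2)"
proof -
  interpret flake2 m n by unfold_locales (fact assms)+
  have y: "1 + [:0, 1:] = ([:1, 1:] :: int poly)" by (simp add: one_pCons)
  have J: "J_poly m n = bsum [:0, 1:] 0 m n"
    unfolding J_poly_def bsum_def y by simp
  have K: "K_poly k l = (1 + [:0, 1:]) * bsum [:0, 1:] 2 (k - 1) (l + 1)" for k l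
    unfolding K_poly_def bsum_upto[of "k - 1" k, OF diff_le_self] y sum_distrib_left
    by (intro sum.cong refl) (simp only: power_add power_one_right ac_simps)
  show ?thesis
    using ZZ_flake unfolding det_2 vector_2 J K path_det_def flake_def by (simp only: mult.commute)
qed

end
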